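(* Let $\rho$ be a reduced word. Then $\mathrm{drop}(\rho)$ (which does not depend on the choices made in its construction) is the unique reduced word that is Coxeter–Knuth equivalent to $\rho$ and whose descent tableau is an increasing Young tableau (in particular of partition shape).
   Context: Reduced words: a word $(\rho_\ell,\ldots,\rho_1)$ of positive integers ($\rho_\ell$ leftmost) is reduced if $s_{\rho_\ell}\cdots s_{\rho_1}$ is a permutation with exactly $\ell$ inversions ($s_i=(i\ i{+}1)$). Coxeter–Knuth equivalence. For $\rho=(\rho_m,\ldots,\rho_1)$: $\mathfrak c_j$ ($1\le j<m$) swaps $\rho_j,\rho_{j+1}$ if $|\rho_j-\rho_{j+1}|>1$, else identity; $\mathfrak b_j$ ($1<j<m$) replaces $\rho_{j+1}\rho_j\rho_{j-1}$ by $\rho_j\rho_{j+1}\rho_j$ if $\rho_{j+1}=\rho_{j-1}$, else identity. $\mathfrak d_i(\rho)$ ($1<i<m$) is $\mathfrak b_i(\rho)$ if $\rho_{i+1}=\rho_{i-1}=\rho_i\pm1$; $\mathfrak c_{i-1}(\rho)$ if $\rho_{i-1}>\rho_{i+1}>\rho_i$ or $\rho_{i-1}<\rho_{i+1}<\rho_i$; $\mathfrak c_i(\rho)$ if $\rho_{i+1}>\rho_{i-1}>\rho_i$ or $\rho_{i+1}<\rho_{i-1}<\rho_i$; $\rho$ otherwise. Coxeter–Knuth equivalence is the equivalence relation generated by the $\mathfrak d_i$. Runs and tableaux. The run decomposition writes $\rho=\rho^{(k)}\cdots\rho^{(1)}$ as maximal consecutive segments strictly increasing from left to right; the descent tableau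 $\mathbb D(\rho)$ is the left-justified array with row $j$ (row 1 at the bottom) equal to $\rho^{(j)}$. An increasing Young tableau is a left-justified array with row lengths weakly decreasing upward, rows strictly increasing left to right and columns strictly increasing upward. The row reading word of rows $R_1$ (bottom),\dots,$R_m$ is $R_m\cdots R_1$. Drop. Increasing words are written left to right, $\tau=\tau_1\cdots\tau_t$, $\tau_1<\cdots<\tau_t$, $\sigma=\sigma_1\cdots\sigma_s$. Drop alignment of $\sigma$ below $\tau$: if $\tau_j>\sigma_j$ for all $j\le\min(s,t)$, $\sigma_j$ goes to column $j$; otherwise with $j_1$ least such that $\tau_{j_1}\le\sigma_{j_1}$, $\sigma_1..\sigma_{j_1-1}$ go to columns $1..j_1-1$, column $j_1$ gets nothing, and $\sigma_{j_1}\cdots\sigma_s$ is aligned recursively below $\tau_{j_1+1}\cdots\tau_t$. With $x_1,\dots,x_k$ the letters of $\tau$ with nothing below (left to right), $\tau=\tau^{(0)}x_1\tau^{(1)}\cdots x_k\tau^{(k)}$, $\sigma=\sigma^{(0)}\cdots\sigma^{(k)}\sigma^{(k+1)}$ with $\sigma^{(j)}$ directly below $\tau^{(j)}$ and $\sigma^{(k+1)}$ right of column $t$. For $\tau\sigma$ reduced, $\mathrm{drop}(\tau\sigma)=(\tau^{(0)}\cdots\tau^{(k)},\ \sigma^{(0)}x_1\hat\sigma^{(1)}\cdots x_k\hat\sigma^{(k)}\sigma^{(k+1)})$ (top row, bottom row), with $\hat\sigma^{(j)}_i=\sigma^{(j)}_i+1$ for $i\le b_j$, else unchanged, where $b_j=\max\{b\ge0:\tau^{(j)}_i=\sigma^{(j)}_1+i\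 \forall i\le b\}$ if $x_j=\tau^{(j)}_1-1$, else $b_j=0$. For a sequence of increasing rows $R_1$ (bottom),\dots,$R_m$ with reduced reading word, $\mathrm{drop}_i$ replaces $(R_{i+1},R_i)$ by $\mathrm{drop}(R_{i+1}R_i)$. The word $\mathrm{drop}(\rho)$: start from the run decomposition of $\rho$ as rows; while the nonempty rows do not form an increasing Young tableau, choose any $k$ such that $|R_{k+1}|>|R_k|$ or $R_{k+1,j}\le R_{k,j}$ for some $j\le\min(|R_k|,|R_{k+1}|)$ (where $R_{k,j}$ is the $j$-th letter of $R_k$) and apply $\mathrm{drop}_k$; $\mathrm{drop}(\rho)$ is the row reading word of the final array. *)

theory Defs
  imports "HOL-Combinatorics.Transposition"
begin

text \<open>
  Words are lists in reading order, so \<open>(\<rho>\<^sub>m, \<dots>, \<rho>\<^sub>1)\<close> is a list whose head is \<open>\<rho>\<^sub>m\<close>.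
  Arrays are lists of rows with the bottom row first; rows are 0-indexed.
\<close>

type_synonym word = "nat list"
type_synonym array = "nat list list"


subsection \<open>Reduced words\<close>

definition word_perm :: "word \<Rightarrow> nat \<Rightarrow> nat" where
  "word_perm \<rho> = foldr (\<lambda>i w. transpose i (i + 1) \<circ> w) \<rho> id"

definition inversions :: "(nat \<Rightarrow> nat) \<Rightarrow> (nat \<times> nat) set" where
  "inversions w = {(a, b). a < b \<and> w b < w a}"

definition reduced_word :: "word \<Rightarrow> bool" where
  "reduced_word \<rho> \<longleftrightarrow> (\<forall>a\<in>set \<rho>. 0 < a) \<and> card (inversions (word_perm \<rho>)) = length \<rho>"


subsection \<open>Coxeter--Knuth equivalence\<close>

text \<open>\<open>letter \<rho> i\<close> is \<open>\<rho>\<^sub>i\<close>, counted from the right starting with 1.\<close>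

definition letter :: "word \<Rightarrow> nat \<Rightarrow> nat" where
  "letter \<rho> i = \<rho> ! (length \<rho> - i)"

definition set_letter :: "nat \<Rightarrow> nat \<Rightarrow> word \<Rightarrow> word" where
  "set_letter i a \<rho> = \<rho>[length \<rho> - i := a]"

definition cox_c :: "nat \<Rightarrow> word \<Rightarrow> word" where
  "cox_c j \<rho> =
     (if letter \<rho> j > letter \<rho> (j + 1) + 1 \<or> letter \<rho> (j + 1) > letter \<rho> j + 1
      then set_letter j (letter \<rho> (j + 1)) (set_letter (j + 1) (letter \<rho> j) \<rho>)
      else \<rho>)"

definition cox_b :: "nat \<Rightarrow> word \<Rightarrow> word" where
  "cox_b j \<rho> =
     (if letter \<rho> (j + 1) = letter \<rho> (j - 1)
      then set_letter (j + 1) (letter \<rho> j)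
             (set_letter j (letter \<rho> (j + 1)) (set_letter (j - 1) (letter \<rho> j) \<rho>))
      else \<rho>)"

definition cox_d :: "nat \<Rightarrow> word \<Rightarrow> word" where
  "cox_d i \<rho> =
     (let l = letter \<rho> (i + 1); c = letter \<rho> i; r = letter \<rho> (i - 1) in
      if l = r \<and> (r = c + 1 \<or> c = r + 1) then cox_b i \<rho>
      else if r > l \<and> l > c \<or> r < l \<and> l < c then cox_c (i - 1) \<rho>
      else if l > r \<and> r > c \<or> l < r \<and> r < c then cox_c i \<rho>
      else \<rho>)"

definition coxeter_knuth :: "word \<Rightarrow> word \<Rightarrow> bool" where
  "coxeter_knuth = equivclp (\<lambda>\<rho> \<rho>'. \<exists>i. 1 < i \<and> i < length \<rho> \<and> \<rho>' = cox_d i \<rho>)"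


subsection \<open>Runs and tableaux\<close>

text \<open>Maximal strictly increasing segments, listed from left to right.\<close>

fun runs :: "word \<Rightarrow> nat list list" where
  "runs [] = []"
| "runs [a] = [[a]]"
| "runs (a # b # \<rho>) =
     (if a < b then (a # hd (runs (b # \<rho>))) # tl (runs (b # \<rho>))
      else [a] # runs (b # \<rho>))"

definition descent_tableau :: "word \<Rightarrow> array" where
  "descent_tableau \<rho> = rev (runs \<rho>)"

definition row_reading_word :: "array \<Rightarrow> word" where
  "row_reading_word R = concat (rev R)"

definition increasing_young_tableau :: "array \<Rightarrow> bool" where
  "increasing_young_tableau R \<longleftrightarrow>
     (\<forall>r\<in>set R. sorted_wrt (<) r) \<and>
     (\<forall>k. Suc k < length R \<longrightarrow>
        length (R ! Suc k) \<le> length (R ! k) \<and>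
        (\<forall>j < length (R ! Suc k). R ! k ! j < R ! Suc k ! j))"


subsection \<open>The drop of two rows\<close>

text \<open>
  \<open>drop_cols \<tau> \<sigma>\<close> lists the columns (numbered from 1, the letters of \<open>\<tau>\<close> occupying
  columns \<open>1, \<dots>, length \<tau>\<close>) that the letters of \<open>\<sigma>\<close> go to in the drop alignment of \<open>\<sigma>\<close>
  below \<open>\<tau>\<close>. The local \<open>j\<close> is \<open>j\<^sub>1 - 1\<close>.
\<close>

function drop_cols :: "nat list \<Rightarrow> nat list \<Rightarrow> nat list" where
  "drop_cols \<tau> \<sigma> =
     (if \<forall>j < min (length \<sigma>) (length \<tau>). \<tau> ! j > \<sigma> ! j then [1..<length \<sigma> + 1]
      else let j = (LEAST j. j < min (length \<sigma>) (length \<tau>) \<and> \<tau> ! j \<le> \<sigma> ! j)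
           in [1..<j + 1] @ map (\<lambda>c. c + (j + 1)) (drop_cols (drop (j + 1) \<tau>) (drop j \<sigma>)))"
  by auto
termination
proof (relation "measure (\<lambda>(\<tau>, \<sigma>). length \<tau>)", goal_cases)
  case (2 \<tau> \<sigma> j)
  then have "\<exists>j. j < min (length \<sigma>) (length \<tau>) \<and> \<tau> ! j \<le> \<sigma> ! j"
    by (auto simp: not_less)
  from LeastI_ex[OF this] 2(2) show ?case by auto
qed simp

declare drop_cols.simps [simp del]

text \<open>The columns of the letters \<open>x\<^sub>1, \<dots>, x\<^sub>k\<close> of \<open>\<tau>\<close> with nothing below.\<close>

definition drop_free :: "nat list \<Rightarrow> nat list \<Rightarrow> nat list" where
  "drop_free \<tau> \<sigma> = filter (\<lambda>c. c \<notin> set (drop_cols \<tau> \<sigma>)) [1..<length \<tau> + 1]"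

text \<open>The columns of \<open>x\<^sub>j\<close> and \<open>x\<^sub>j\<^sub>+\<^sub>1\<close> are entries \<open>j\<close> and \<open>j + 1\<close> of this list, with sentinels
  \<open>0\<close> and \<open>length \<tau> + 1\<close>. The blocks \<open>\<tau>\<^sup>(\<^sup>j\<^sup>)\<close> and \<open>\<sigma>\<^sup>(\<^sup>j\<^sup>)\<close> lie strictly between them.\<close>

definition drop_bounds :: "nat list \<Rightarrow> nat list \<Rightarrow> nat list" where
  "drop_bounds \<tau> \<sigma> = 0 # drop_free \<tau> \<sigma> @ [length \<tau> + 1]"

definition drop_letter :: "nat list \<Rightarrow> nat list \<Rightarrow> nat \<Rightarrow> nat" where
  "drop_letter \<tau> \<sigma> j = \<tau> ! (drop_bounds \<tau> \<sigma> ! j - 1)"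

definition top_block :: "nat list \<Rightarrow> nat list \<Rightarrow> nat \<Rightarrow> nat list" where
  "top_block \<tau> \<sigma> j =
     [\<tau> ! (c - 1). c \<leftarrow> [drop_bounds \<tau> \<sigma> ! j + 1..<drop_bounds \<tau> \<sigma> ! (j + 1)]]"

definition bottom_block :: "nat list \<Rightarrow> nat list \<Rightarrow> nat \<Rightarrow> nat list" where
  "bottom_block \<tau> \<sigma> j =
     [\<sigma> ! i. i \<leftarrow> [0..<length \<sigma>],
        drop_bounds \<tau> \<sigma> ! j < drop_cols \<tau> \<sigma> ! i \<and>
        drop_cols \<tau> \<sigma> ! i < drop_bounds \<tau> \<sigma> ! (j + 1)]"

definition right_block :: "nat list \<Rightarrow> nat list \<Rightarrow> nat list" where
  "right_block \<tau> \<sigma> = [\<sigma> ! i. i \<leftarrow> [0..<length \<sigma>], length \<tau> < drop_cols \<tau> \<sigma> ! i]"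

text \<open>
  \<open>hat_count x \<tau>' \<sigma>'\<close> is \<open>b\<^sub>j\<close> for \<open>x = x\<^sub>j\<close> and the blocks \<open>\<tau>' = \<tau>\<^sup>(\<^sup>j\<^sup>)\<close>, \<open>\<sigma>' = \<sigma>\<^sup>(\<^sup>j\<^sup>)\<close>,
  and \<open>hat_block x \<tau>' \<sigma>'\<close> is \<open>\<sigma>'\<close> with its first \<open>b\<^sub>j\<close> letters raised by 1.
  If \<open>\<tau>'\<close> is empty then \<open>b\<^sub>j = 0\<close>.
\<close>

definition hat_count :: "nat \<Rightarrow> nat list \<Rightarrow> nat list \<Rightarrow> nat" where
  "hat_count x \<tau>' \<sigma>' =
     (if \<tau>' \<noteq> [] \<and> \<tau>' ! 0 = x + 1
      then Max {b. b \<le> length \<tau>' \<and> (\<forall>i\<in>{1..b}. \<tau>' ! (i - 1) = \<sigma>' ! 0 + i)}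
      else 0)"

definition hat_block :: "nat \<Rightarrow> nat list \<Rightarrow> nat list \<Rightarrow> nat list" where
  "hat_block x \<tau>' \<sigma>' =
     map Suc (take (hat_count x \<tau>' \<sigma>') \<sigma>') @ drop (hat_count x \<tau>' \<sigma>') \<sigma>'"

text \<open>The pair (top row, bottom row) of \<open>drop(\<tau>\<sigma>)\<close>; meaningful for increasing \<open>\<tau>\<close>, \<open>\<sigma>\<close>
  with \<open>\<tau>\<sigma>\<close> reduced.\<close>

definition drop_rows :: "nat list \<Rightarrow> nat list \<Rightarrow> nat list \<times> nat list" where
  "drop_rows \<tau> \<sigma> =
     (let k = length (drop_free \<tau> \<sigma>) in
      (concat [top_block \<tau> \<sigma> j. j \<leftarrow> [0..<k + 1]],
       bottom_block \<tau> \<sigma> 0 @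
       concat [drop_letter \<tau> \<sigma> j #
                 hat_block (drop_letter \<tau> \<sigma> j) (top_block \<tau> \<sigma> j) (bottom_block \<tau> \<sigma> j).
               j \<leftarrow> [1..<k + 1]] @
       right_block \<tau> \<sigma>))"


subsection \<open>The drop of a word\<close>

definition drop_at :: "nat \<Rightarrow> array \<Rightarrow> array" where
  "drop_at k R =
     (let (top_row, bottom_row) = drop_rows (R ! Suc k) (R ! k)
      in R[Suc k := top_row, k := bottom_row])"

text \<open>The arrays on which the operations \<open>drop_at\<close> are meaningful.\<close>

definition drop_admissible :: "array \<Rightarrow> bool" where
  "drop_admissible R \<longleftrightarrow>
     (\<forall>r\<in>set R. sorted_wrt (<) r) \<and> reduced_word (row_reading_word R)"

definition drop_finished :: "array \<Rightarrow> bool" where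
  "drop_finished R \<longleftrightarrow> increasing_young_tableau (filter (\<lambda>r. r \<noteq> []) R)"

text \<open>One step of the procedure, for any permitted choice of \<open>k\<close>.\<close>

definition drop_step :: "array \<Rightarrow> array \<Rightarrow> bool" where
  "drop_step R R' \<longleftrightarrow>
     \<not> drop_finished R \<and>
     (\<exists>k. Suc k < length R \<and>
        (length (R ! Suc k) > length (R ! k) \<or>
         (\<exists>j < min (length (R ! k)) (length (R ! Suc k)). R ! Suc k ! j \<le> R ! k ! j)) \<and>
        R' = drop_at k R)"

definition drop_reachable :: "word \<Rightarrow> array \<Rightarrow> bool" where
  "drop_reachable \<rho> R \<longleftrightarrow> drop_step\<^sup>*\<^sup>* (descent_tableau \<rho>) R"

definition drop_word :: "word \<Rightarrow> word" where
  "drop_word \<rho> =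
     (THE w. \<exists>R. drop_reachable \<rho> R \<and> drop_finished R \<and> w = row_reading_word R)"

text \<open>
  The procedure defining \<open>drop_word \<rho>\<close> is well defined: every array that occurs is admissible,
  no sequence of choices runs forever or gets stuck before the procedure is finished, and all
  sequences of choices end with the same word.
\<close>

definition drop_well_defined :: "word \<Rightarrow> bool" where
  "drop_well_defined \<rho> \<longleftrightarrow>
     (\<forall>R. drop_reachable \<rho> R \<longrightarrow> drop_admissible R) \<and>
     (\<nexists>f. f 0 = descent_tableau \<rho> \<and> (\<forall>n. drop_step (f n) (f (Suc n)))) \<and>
     (\<forall>R. drop_reachable \<rho> R \<longrightarrow> drop_finished R \<or> (\<exists>R'. drop_step R R')) \<and>
     (\<forall>R. drop_reachable \<rho> R \<and> drop_finished R \<longrightarrow> row_reading_word R = drop_word \<rho>)"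

end

theory Submission
  imports Defs
begin

text \<open>
  The operation \<open>drop(\<tau>\<sigma>)\<close> is Edelman--Greene row insertion in disguise: inserting the letters of
  \<open>\<sigma>\<close> one by one into the row \<open>\<tau>\<close> bumps out exactly the new top row and leaves exactly the new
  bottom row, the raised letters coming from insertions of a letter that is already present.
  Hence every drop preserves the Coxeter--Knuth class, and since it moves letters down whenever it
  is permitted, the procedure terminates in an increasing tableau. For uniqueness, a Coxeter--Knuth
  move on a word does not change the row obtained by inserting the word into the empty row and
  changes the bumped word only within its Coxeter--Knuth class; for the reading word of an
  increasing tableau this row is the bottom row and the bumped word reads the remaining rows, so
  induction recovers the tableau from the class.
\<close>

subsection \<open>Reduced words\<close>

text \<open>The delicate insertion is that of a letter x already present: it can be realised by a
  braid move only if x + 1 is in the row as well. Reducedness supplies this, since otherwise x would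
  commute past everything after its first occurrence and cancel it. So reducedness is carried to
  every intermediate row, as a factor of a word equivalent to the original one. The same case
  explains the number of raised letters in the drop. If the row continues a free letter x by x + 1,
  ..., x + b, and x, x + 1, ..., x + b - 1 arrive in turn, each arriving letter is present, leaves
  the row unchanged and bumps its successor; the column meant for it therefore holds the letter plus
  1. The initial block has no free letter on its left, and nothing is raised there. Independence of
  the choices needs no confluence argument: all results are words of tableaux in one class, and
  uniqueness identifies them.\<close>

lemma word_perm_Nil [simp]: "word_perm [] = id"
  by (simp add: word_perm_def)

lemma word_perm_Cons [simp]: "word_perm (i # \<rho>) = transpose i (Suc i) \<circ> word_perm \<rho>"
  by (simp add: word_perm_def)

lemma word_perm_append [simp]: "word_perm (u @ v) = word_perm u \<circ> word_perm v"
  by (induction u) (simp_all add: comp_assoc)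

lemma inj_word_perm: "inj (word_perm \<rho>)"
proof (induction \<rho>)
  case (Cons i \<rho>)
  then show ?case
    unfolding word_perm_Cons by (intro inj_compose) simp_all
qed simp

lemma inversions_ident [simp]: "inversions (\<lambda>a. a) = {}"
  by (auto simp: inversions_def)

text \<open>Multiplication on the left exchanges the values i and i + 1, so only the pair of
  positions carrying these two values can become inverted.\<close>

lemma inversions_transpose_comp:
  assumes "inj w"
  shows "\<exists>p. inversions (transpose i (Suc i) \<circ> w) \<subseteq> insert p (inversions w)"
proof -
  have *: "w a = i \<and> w b = Suc i"
    if "(a, b) \<in> inversions (transpose i (Suc i) \<circ> w) - inversions w" for a b
    using that inj_eq[OF assms, of a b]
    by (auto simp: inversions_def transpose_def split: if_splits)
  show ?thesis
  proof (cases "inversions (transpose i (Suc i) \<circ> w) \<subseteq> inversions w")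
    case False
    then obtain a b where "(a, b) \<in> inversions (transpose i (Suc i) \<circ> w) - inversions w"
      by auto
    then have "w a = i" "w b = Suc i" using * by blast+
    then have "inversions (transpose i (Suc i) \<circ> w) - inversions w \<subseteq> {(a, b)}"
      using * injD[OF assms] by (metis insertI1 subrelI)
    then show ?thesis by blast
  qed blast
qed

text \<open>Multiplication on the right exchanges the positions i and i + 1, so inversions are
  merely relabelled. The exception is (i, i + 1), the only pair whose order the relabelling
  reverses.\<close>

lemma inversions_comp_transpose:
  "inversions (w \<circ> transpose i (Suc i)) \<subseteq>
     insert (i, Suc i) (map_prod (transpose i (Suc i)) (transpose i (Suc i)) ` inversions w)"
proof clarify
  fix a b
  assume *: "(a, b) \<in> inversions (w \<circ> transpose i (Suc i))"
    "(a, b) \<notin> map_prod (transpose i (Suc i)) (transpose i (Suc i)) ` inversions w"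
  let ?t = "transpose i (Suc i)"
  have "(?t a, ?t b) \<notin> inversions w"
  proof
    assume "(?t a, ?t b) \<in> inversions w"
    then have "map_prod ?t ?t (?t a, ?t b) \<in> map_prod ?t ?t ` inversions w" by (rule imageI)
    with * show False by simp
  qed
  with *(1) show "a = i \<and> b = Suc i"
    by (auto simp: inversions_def transpose_def split: if_splits)
qed

lemma finite_inversions: "finite (inversions (word_perm \<rho>))"
proof (induction \<rho>)
  case (Cons i \<rho>)
  then show ?case
    using inversions_transpose_comp[OF inj_word_perm, of i \<rho>] by (auto simp: o_def intro: finite_subset)
qed (simp add: id_def)

lemma card_inversions_append_left:
  "card (inversions (word_perm (u @ v))) \<le> length u + card (inversions (word_perm v))"
proof (induction u)
  case (Cons i u)
  obtain p where "inversions (word_perm (i # u @ v)) \<subseteq> insert p (inversions (word_perm (u @ v)))"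
    using inversions_transpose_comp[OF inj_word_perm, of i "u @ v"] by auto
  then have "card (inversions (word_perm (i # u @ v))) \<le> card (insert p (inversions (word_perm (u @ v))))"
    by (intro card_mono) (simp_all add: finite_inversions del: word_perm_append)
  also have "\<dots> \<le> Suc (card (inversions (word_perm (u @ v))))"
    by (simp add: card_insert_if finite_inversions del: word_perm_append)
  finally show ?case using Cons by (simp add: o_def)
qed simp

lemma card_inversions_append_right:
  "card (inversions (word_perm (u @ v))) \<le> card (inversions (word_perm u)) + length v"
proof (induction v rule: rev_induct)
  case (snoc i v)
  let ?I = "inversions (word_perm (u @ v))" and ?t = "transpose i (Suc i)"
  have "card (inversions (word_perm (u @ v @ [i]))) \<le> card (insert (i, Suc i) (map_prod ?t ?t ` ?I))"
    using inversions_comp_transpose[of "word_perm (u @ v)" i]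
    by (intro card_mono finite.insertI finite_imageI finite_inversions) (simp add: comp_assoc)
  also have "\<dots> \<le> Suc (card ?I)"
    using card_image_le[OF finite_inversions, of "map_prod ?t ?t" "u @ v"]
    by (simp add: card_insert_if finite_inversions del: word_perm_append)
  finally show ?case using snoc by (simp add: o_def)
qed simp

lemma card_inversions_le_length: "card (inversions (word_perm \<rho>)) \<le> length \<rho>"
  using card_inversions_append_left[of \<rho> "[]"] by (simp add: id_def)

text \<open>A letter adds at most one inversion, so a prefix with fewer inversions than letters
  leaves a deficit that the rest of the word cannot make up.\<close>

lemma reduced_word_appendD1: "reduced_word (u @ v) \<Longrightarrow> reduced_word u"
  using card_inversions_append_right[of u v] card_inversions_le_length[of u]
  by (auto simp: reduced_word_def)

lemma reduced_word_appendD2: "reduced_word (u @ v) \<Longrightarrow> reduced_word v"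
  using card_inversions_append_left[of u v] card_inversions_le_length[of v]
  by (auto simp: reduced_word_def)

section \<open>Relations between adjacent transpositions\<close>

lemma transpose_commute_far:
  "Suc i < j \<Longrightarrow> transpose i (Suc i) \<circ> transpose j (Suc j) = transpose j (Suc j) \<circ> transpose i (Suc i)"
  by (auto simp: fun_eq_iff transpose_def)

lemma transpose_braid:
  "transpose i (Suc i) \<circ> transpose (Suc i) (Suc (Suc i)) \<circ> transpose i (Suc i) =
   transpose (Suc i) (Suc (Suc i)) \<circ> transpose i (Suc i) \<circ> transpose (Suc i) (Suc (Suc i))"
  by (auto simp: fun_eq_iff transpose_def)

lemma word_perm_commute_far:
  "\<forall>b\<in>set B. Suc x < b \<Longrightarrow> word_perm (x # B) = word_perm (B @ [x])"
proof (induction B)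
  case (Cons b B)
  then have IH: "transpose x (Suc x) \<circ> word_perm B = word_perm B \<circ> transpose x (Suc x)"
    by (simp add: fun_eq_iff)
  have "transpose x (Suc x) \<circ> (transpose b (Suc b) \<circ> word_perm B) =
      transpose b (Suc b) \<circ> (transpose x (Suc x) \<circ> word_perm B)"
    using transpose_commute_far[of x b] Cons.prems by (simp flip: comp_assoc)
  with IH show ?case by (simp add: fun_eq_iff)
qed simp

text \<open>The first x commutes past B and cancels the last one, so the permutation already has a
  word that is shorter by two letters.\<close>

lemma not_reduced_word_repeat:
  assumes "\<forall>b\<in>set B. Suc x < b"
  shows "\<not> reduced_word (x # B @ [x])"
proof
  assume "reduced_word (x # B @ [x])"
  moreover have "word_perm (x # B @ [x]) = word_perm B"
    using word_perm_commute_far[OF assms] by (simp add: fun_eq_iff)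
  ultimately show False
    using card_inversions_le_length[of B] by (simp add: reduced_word_def del: word_perm_Cons word_perm_append)
qed

text \<open>The form in which reducedness enters row insertion. Without x + 1, all letters to the
  right of x would exceed x + 1, and the word would end in a forbidden repetition of x.\<close>

lemma reduced_row_Suc_mem:
  assumes "sorted_wrt (<) R" "reduced_word (R @ [x])" "x \<in> set R"
  shows "Suc x \<in> set R"
proof (rule ccontr)
  assume no: "Suc x \<notin> set R"
  from assms(3) obtain A B where R: "R = A @ x # B" by (auto simp: in_set_conv_decomp)
  have "Suc x < b" if "b \<in> set B" for b
    using that assms(1) no unfolding R by (auto simp: sorted_wrt_append intro: Suc_lessI)
  moreover have "reduced_word (x # B @ [x])"
    using assms(2) reduced_word_appendD2[of A] by (simp add: R)
  ultimately show False using not_reduced_word_repeat by blast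
qed

subsection \<open>Coxeter--Knuth equivalence\<close>

text \<open>The moves of \<open>cox_d\<close>, each in one orientation; \<open>left\<close> and
  \<open>right\<close> tell on which side of the exchanged letters a and c the witness b stands. The
  contexts u and v replace indices counted from the right, so that the moves are compatible with
  concatenation.\<close>

inductive ck_step :: "word \<Rightarrow> word \<Rightarrow> bool" where
  left: "a < b \<Longrightarrow> b < c \<Longrightarrow> ck_step (u @ [b, a, c] @ v) (u @ [b, c, a] @ v)"
| right: "a < b \<Longrightarrow> b < c \<Longrightarrow> ck_step (u @ [a, c, b] @ v) (u @ [c, a, b] @ v)"
| braid: "ck_step (u @ [a, Suc a, a] @ v) (u @ [Suc a, a, Suc a] @ v)"

lemma ck_step_context: "ck_step x y \<Longrightarrow> ck_step (p @ x @ q) (p @ y @ q)"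
proof (induction rule: ck_step.induct)
  case (left a b c u v)
  then show ?case using ck_step.left[of a b c "p @ u" "v @ q"] by simp
next
  case (right a b c u v)
  then show ?case using ck_step.right[of a b c "p @ u" "v @ q"] by simp
next
  case (braid u a v)
  then show ?case using ck_step.braid[of "p @ u" a "v @ q"] by simp
qed

text \<open>Counted from the right, \<open>length v + 2\<close> is the middle letter of the window.
  The guard of \<open>cox_c\<close> disappears: whenever it is called, the third letter lies
  strictly between the two exchanged ones, which therefore differ by more than 1.\<close>

lemma cox_d_append:
  "cox_d (length v + 2) (u @ [l, c, r] @ v) =
     u @ (if l = r \<and> (r = c + 1 \<or> c = r + 1) then [c, l, c]
          else if r > l \<and> l > c \<or> r < l \<and> l < c then [l, r, c]
          else if l > r \<and> r > c \<or> l < r \<and> r < c then [c, l, r]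
          else [l, c, r]) @ v"
proof -
  let ?w = "\<lambda>l c r. u @ [l, c, r] @ v"
  have let_w: "letter (?w l c r) (length v + 3) = l" "letter (?w l c r) (length v + 2) = c"
    "letter (?w l c r) (length v + 1) = r" for l c r
    by (simp_all add: letter_def nth_append)
  have set_w: "set_letter (length v + 3) x (?w l c r) = ?w x c r"
    "set_letter (length v + 2) x (?w l c r) = ?w l x r"
    "set_letter (length v + 1) x (?w l c r) = ?w l c x" for l c r x
    by (simp_all add: set_letter_def list_update_append)
  have ind: "length v + 2 + 1 = length v + 3" "length v + 2 - 1 = length v + 1"
    "length v + 1 + 1 = length v + 2"
    by simp_all
  show ?thesis
    unfolding cox_d_def cox_b_def cox_c_def Let_def ind let_w set_w by auto
qed

lemma cox_d_ck_step:
  assumes "1 < i" "i < length \<rho>"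
  shows "cox_d i \<rho> = \<rho> \<or> ck_step \<rho> (cox_d i \<rho>) \<or> ck_step (cox_d i \<rho>) \<rho>"
proof -
  define u where "u = take (length \<rho> - (i + 1)) \<rho>"
  define w where "w = drop (length \<rho> - (i + 1)) \<rho>"
  have "length w = Suc (Suc (Suc (i - 2)))"
    using assms by (simp add: w_def)
  then obtain l c r v where w: "w = [l, c, r] @ v" and v: "length v = i - 2"
    by (auto simp: length_Suc_conv)
  have \<rho>: "\<rho> = u @ [l, c, r] @ v"
    using w by (metis append_take_drop_id u_def w_def)
  have i: "i = length v + 2"
    using v assms by simp
  show ?thesis
    unfolding \<rho> i cox_d_append
    using ck_step.left[of c l r u v] ck_step.left[of r l c u v] ck_step.right[of l r c u v]
      ck_step.right[of c r l u v] ck_step.braid[of u l v] ck_step.braid[of u c v]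
    by (simp split del: if_split) (auto split: if_splits)
qed

lemma ck_step_cox_d:
  assumes "ck_step \<rho> \<rho>'"
  shows "\<exists>i. 1 < i \<and> i < length \<rho> \<and> \<rho>' = cox_d i \<rho>"
proof -
  have *: "\<exists>i. 1 < i \<and> i < length (u @ [l, c, r] @ v) \<and> \<rho>' = cox_d i (u @ [l, c, r] @ v)"
    if "\<rho>' = cox_d (length v + 2) (u @ [l, c, r] @ v)" for u l c r v
    using that by (intro exI[of _ "length v + 2"]) simp
  from assms show ?thesis
  proof cases
    case (left a b c u v)
    show ?thesis unfolding left(1)
      by (rule *, unfold cox_d_append left(2)) (use left(3,4) in auto)
  next
    case (right a b c u v)
    show ?thesis unfolding right(1)
      by (rule *, unfold cox_d_append right(2)) (use right(3,4) in auto)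
  next
    case (braid u a v)
    show ?thesis unfolding braid(1)
      by (rule *, unfold cox_d_append braid(2)) auto
  qed
qed

definition ck_equiv :: "word \<Rightarrow> word \<Rightarrow> bool" where
  "ck_equiv = equivclp ck_step"

lemma ck_equiv_refl [simp]: "ck_equiv x x"
  by (simp add: ck_equiv_def)

lemma ck_equiv_sym: "ck_equiv x y \<Longrightarrow> ck_equiv y x"
  by (simp add: ck_equiv_def equivclp_sym)

lemma ck_equiv_trans [trans]: "ck_equiv x y \<Longrightarrow> ck_equiv y z \<Longrightarrow> ck_equiv x z"
  unfolding ck_equiv_def by (rule equivclp_trans)

lemma ck_equiv_step: "ck_step x y \<Longrightarrow> ck_equiv x y"
  unfolding ck_equiv_def by blast

lemma ck_equiv_induct [consumes 1, case_names refl step]: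
  assumes "ck_equiv x y" "P x"
    "\<And>y z. ck_equiv x y \<Longrightarrow> ck_step y z \<or> ck_step z y \<Longrightarrow> P y \<Longrightarrow> P z"
  shows "P y"
  using assms unfolding ck_equiv_def by (rule equivclp_induct)

lemma cox_d_ck_equiv: "1 < i \<Longrightarrow> i < length \<rho> \<Longrightarrow> ck_equiv \<rho> (cox_d i \<rho>)"
  by (drule (1) cox_d_ck_step) (auto intro: ck_equiv_step ck_equiv_sym)

lemma coxeter_knuth_eq_ck_equiv: "coxeter_knuth = ck_equiv"
proof (intro ext iffI)
  fix x y
  assume "coxeter_knuth x y"
  then show "ck_equiv x y"
    unfolding coxeter_knuth_def
  proof (induction rule: equivclp_induct)
    case (step y z)
    then have "ck_equiv y z"
      by (metis cox_d_ck_equiv ck_equiv_sym)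
    with step show ?case by (blast intro: ck_equiv_trans)
  qed simp
next
  have ck: "coxeter_knuth x y" if "ck_step x y" for x y
    unfolding coxeter_knuth_def by (rule r_into_equivclp, rule ck_step_cox_d[OF that])
  fix x y
  assume "ck_equiv x y"
  then show "coxeter_knuth x y"
  proof (induction rule: ck_equiv_induct)
    case (step y z)
    from step(2) have "coxeter_knuth y z"
    proof
      assume "ck_step z y"
      from ck[OF this] show ?thesis unfolding coxeter_knuth_def by (rule equivclp_sym)
    qed (rule ck)
    with step(3) show ?case unfolding coxeter_knuth_def by (rule equivclp_trans)
  qed (simp add: coxeter_knuth_def)
qed

lemma ck_equiv_context: "ck_equiv x y \<Longrightarrow> ck_equiv (p @ x @ q) (p @ y @ q)"
proof (induction rule: ck_equiv_induct)
  case (step y z)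
  then have "ck_equiv (p @ y @ q) (p @ z @ q)"
    by (blast intro: ck_step_context ck_equiv_step ck_equiv_sym)
  with step show ?case by (blast intro: ck_equiv_trans)
qed simp

lemma ck_equiv_append_left: "ck_equiv x y \<Longrightarrow> ck_equiv (p @ x) (p @ y)"
  using ck_equiv_context[of x y p "[]"] by simp

lemma ck_equiv_append_right: "ck_equiv x y \<Longrightarrow> ck_equiv (x @ q) (y @ q)"
  using ck_equiv_context[of x y "[]" q] by simp

text \<open>The witness b between a and c forces a gap of at least 2, so the transpositions of a and
  c commute; the third move is the braid relation.\<close>

lemma ck_step_invariants:
  "ck_step x y \<Longrightarrow> word_perm x = word_perm y \<and> length x = length y \<and> set x = set y"
proof (induction rule: ck_step.induct)
  case (left a b c u v)
  then show ?case using transpose_commute_far[of a c] by (auto simp: fun_eq_iff)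
next
  case (right a b c u v)
  then show ?case using transpose_commute_far[of a c] by (auto simp: fun_eq_iff)
next
  case (braid u a v)
  then show ?case using transpose_braid[of a] by (auto simp: fun_eq_iff)
qed

lemma ck_equiv_invariants:
  "ck_equiv x y \<Longrightarrow> word_perm x = word_perm y \<and> length x = length y \<and> set x = set y"
  by (induction rule: ck_equiv_induct) (use ck_step_invariants in metis)+

lemma reduced_word_ck_equiv: "ck_equiv x y \<Longrightarrow> reduced_word x \<longleftrightarrow> reduced_word y"
  using ck_equiv_invariants[of x y] by (simp add: reduced_word_def)

subsection \<open>Edelman--Greene row insertion\<close>

text \<open>Edelman--Greene insertion of a letter into a row. When \<open>x\<close> already occurs, reducedness
  guarantees that \<open>Suc x\<close> is the next entry, so that \<open>Suc x\<close> is bumped and the row is unchanged.\<close>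

fun bump :: "nat \<Rightarrow> nat list \<Rightarrow> nat list \<times> nat list" where
  "bump x [] = ([], [x])"
| "bump x (y # R) =
     (if x < y then ([y], x # R) else if x = y then ([Suc x], y # R)
      else map_prod id ((#) y) (bump x R))"

fun row_ins :: "nat list \<Rightarrow> word \<Rightarrow> nat list \<times> nat list" where
  "row_ins R [] = ([], R)"
| "row_ins R (x # w) =
     (case bump x R of (p, S) \<Rightarrow> case row_ins S w of (q, T) \<Rightarrow> (p @ q, T))"

lemma bump_append:
  "\<forall>y\<in>set A. y < x \<Longrightarrow> bump x (A @ B) = map_prod id ((@) A) (bump x B)"
  by (induction A) (auto simp: prod.map_comp comp_def id_def map_prod_def split: prod.splits)

lemma bump_above: "\<forall>y\<in>set R. y < x \<Longrightarrow> bump x R = ([], R @ [x])"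
  using bump_append[of R x "[]"] by simp

text \<open>Splits the row at its first entry that is not below x, so that later proofs work with
  explicit prefixes and suffixes in place of the recursion of \<open>bump\<close>.\<close>

lemma bump_cases [case_names append replace mem]:
  assumes "\<forall>y\<in>set R. y < x \<Longrightarrow> bump x R = ([], R @ [x]) \<Longrightarrow> P"
    and "\<And>A y B. R = A @ y # B \<Longrightarrow> \<forall>a\<in>set A. a < x \<Longrightarrow> x < y \<Longrightarrow>
      bump x R = ([y], A @ x # B) \<Longrightarrow> P"
    and "\<And>A B. R = A @ x # B \<Longrightarrow> \<forall>a\<in>set A. a < x \<Longrightarrow> bump x R = ([Suc x], R) \<Longrightarrow> P"
  shows P
proof -
  have "(\<forall>y\<in>set R. y < x) \<and> bump x R = ([], R @ [x]) \<or>
      (\<exists>A y B. R = A @ y # B \<and> (\<forall>a\<in>set A. a < x) \<and> x < y \<and> bump x R = ([y], A @ x # B)) \<or>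
      (\<exists>A B. R = A @ x # B \<and> (\<forall>a\<in>set A. a < x) \<and> bump x R = ([Suc x], R))"
  proof (cases "\<forall>y\<in>set R. y < x")
    case True
    then show ?thesis by (simp add: bump_above)
  next
    case False
    then obtain A y B where R: "R = A @ y # B" and y: "\<not> y < x" and A: "\<forall>a\<in>set A. \<not> \<not> a < x"
      using split_list_first_prop[of R "\<lambda>y. \<not> y < x"] by blast
    from A have A: "\<forall>a\<in>set A. a < x" by simp
    with R y show ?thesis using bump_append[OF A, of "y # B"]
      by (cases "x = y") (simp_all, blast+)
  qed
  with assms show P by blast
qed

lemma row_ins_append:
  "row_ins R (u @ v) =
     (case row_ins R u of (p, S) \<Rightarrow> case row_ins S v of (q, T) \<Rightarrow> (p @ q, T))"
  by (induction u arbitrary: R) (auto split: prod.splits)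

text \<open>The letter x travels left. Each exchange with a letter b of the row is witnessed by the
  left neighbour of b, which lies between x and b.\<close>

lemma ck_equiv_shift_last:
  "sorted_wrt (<) (y # B) \<Longrightarrow> x < y \<Longrightarrow> ck_equiv (y # B @ [x]) (y # x # B)"
proof (induction B arbitrary: y)
  case (Cons b B)
  then have "ck_equiv (b # B @ [x]) (b # x # B)" by simp
  then have "ck_equiv (y # b # B @ [x]) (y # b # x # B)"
    using ck_equiv_append_left[of _ _ "[y]"] by simp
  also have "ck_equiv \<dots> (y # x # b # B)"
    using ck_step.left[of x y b "[]" B] Cons.prems ck_equiv_step ck_equiv_sym by simp
  finally show ?case by simp
qed simp

text \<open>The bumped letter y travels left. Each exchange with a letter of A is witnessed by the
  current right neighbour of y, which is smaller than y and larger than that letter.\<close>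

lemma ck_equiv_shift_first:
  "sorted_wrt (<) (A @ [x]) \<Longrightarrow> x < y \<Longrightarrow> ck_equiv (A @ y # x # B) (y # A @ x # B)"
proof (induction A arbitrary: x B rule: rev_induct)
  case (snoc a A)
  then have *: "a < x" "sorted_wrt (<) (A @ [a])" by (auto simp: sorted_wrt_append)
  then have "ck_equiv (A @ a # y # x # B) (A @ y # a # x # B)"
    using ck_step.right[of a x y A B] \<open>x < y\<close> ck_equiv_step by simp
  also have "ck_equiv \<dots> (y # A @ a # x # B)"
    using snoc.IH[of a "x # B"] * snoc.prems by simp
  finally show ?case by simp
qed simp

lemma Suc_mem_row:
  assumes "sorted_wrt (<) (A @ x # B)" "Suc x \<in> set (A @ x # B)"
  shows "\<exists>C. B = Suc x # C"
proof -
  have "Suc x \<in> set B" using assms by (auto simp: sorted_wrt_append)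
  then obtain D C where "B = D @ Suc x # C" by (auto simp: in_set_conv_decomp)
  moreover from this have "D = []" using assms(1) by (cases D) (auto simp: sorted_wrt_append)
  ultimately show ?thesis by simp
qed

lemma sorted_bump: "sorted_wrt (<) R \<Longrightarrow> sorted_wrt (<) (snd (bump x R))"
  by (cases rule: bump_cases[of R x]) (auto simp: sorted_wrt_append)

text \<open>The appended x travels left to its place, and the bumped letter travels on to the front.
  If x is already present, the two journeys are joined by the braid move on x, x + 1, x.\<close>

lemma bump_ck_equiv:
  assumes "sorted_wrt (<) R" "reduced_word (R @ [x])"
  shows "ck_equiv (R @ [x]) (fst (bump x R) @ snd (bump x R))"
proof (cases rule: bump_cases[of R x])
  case append
  with assms show ?thesis
    by (simp add: sorted_wrt_append)
next
  case (replace A y B)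
  have "ck_equiv (A @ y # B @ [x]) (A @ y # x # B)"
    using ck_equiv_shift_last[of y B x] ck_equiv_append_left[of _ _ A] assms(1) replace
    by (simp add: sorted_wrt_append)
  also have "ck_equiv \<dots> (y # A @ x # B)"
    using ck_equiv_shift_first[of A x y B] assms(1) replace by (simp add: sorted_wrt_append)
  finally show ?thesis
    using assms(1) replace by (auto simp: sorted_wrt_append)
next
  case (mem A B)
  have "sorted_wrt (<) (A @ x # B)" "Suc x \<in> set (A @ x # B)"
    using reduced_row_Suc_mem[OF assms] assms(1) mem(1) by auto
  then obtain C where B: "B = Suc x # C" using Suc_mem_row by blast
  have "ck_equiv (A @ x # Suc x # C @ [x]) (A @ x # Suc x # x # C)"
    using ck_equiv_shift_last[of "Suc x" C x] ck_equiv_append_left[of _ _ "A @ [x]"] assms(1) mem B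
    by (simp add: sorted_wrt_append)
  also have "ck_equiv \<dots> (A @ Suc x # x # Suc x # C)"
    using ck_equiv_step[OF ck_step.braid[of A x C]] by simp
  also have "ck_equiv \<dots> (Suc x # A @ x # Suc x # C)"
    using ck_equiv_shift_first[of A x "Suc x" "Suc x # C"] assms(1) mem B
    by (simp add: sorted_wrt_append)
  finally show ?thesis
    using assms(1) mem B by simp
qed

lemma row_ins_ck_equiv:
  assumes "sorted_wrt (<) R" "reduced_word (R @ w)" "row_ins R w = (p, S)"
  shows "ck_equiv (R @ w) (p @ S)" and "sorted_wrt (<) S"
proof (atomize (full), use assms in \<open>induction w arbitrary: R p\<close>)
  case (Cons x w)
  obtain p1 R1 where 1: "bump x R = (p1, R1)" by fastforce
  obtain p2 where 2: "row_ins R1 w = (p2, S)" "p = p1 @ p2"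
    using Cons.prems 1 by (auto split: prod.splits)
  have "reduced_word (R @ [x])"
    using Cons.prems(2) reduced_word_appendD1[of "R @ [x]" w] by simp
  from bump_ck_equiv[OF Cons.prems(1) this] sorted_bump[OF Cons.prems(1), of x] 1
  have *: "ck_equiv (R @ [x]) (p1 @ R1)" and sorted: "sorted_wrt (<) R1" by simp_all
  from * have "ck_equiv (R @ x # w) (p1 @ R1 @ w)"
    using ck_equiv_append_right[of "R @ [x]" "p1 @ R1" w] by simp
  moreover from this have "reduced_word (R1 @ w)"
    using Cons.prems(2) reduced_word_ck_equiv reduced_word_appendD2 by blast
  with Cons.IH[OF sorted _ 2(1)] have IH: "ck_equiv (R1 @ w) (p2 @ S)" "sorted_wrt (<) S" by simp_all
  then have "ck_equiv (p1 @ R1 @ w) (p @ S)"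
    using ck_equiv_append_left[of _ _ p1] 2 by simp
  ultimately show ?case using IH ck_equiv_trans by blast
qed simp

section \<open>Row insertion and Coxeter-Knuth moves\<close>

lemma bump_below:
  assumes "a < b" "\<forall>y\<in>set A. y < b"
  obtains r A' where "\<forall>B. bump a (A @ b # B) = ([r], A' @ B)" "r \<le> b" "\<forall>z\<in>set A'. z \<le> b"
proof -
  have "\<exists>r A'. (\<forall>B. bump a (A @ b # B) = ([r], A' @ B)) \<and> r \<le> b \<and> (\<forall>z\<in>set A'. z \<le> b)"
    using assms(2)
  proof (induction A)
    case Nil
    show ?case using assms(1) by (intro exI[of _ b] exI[of _ "[a]"]) simp
  next
    case (Cons y A)
    then obtain r A' where *: "\<forall>B. bump a (A @ b # B) = ([r], A' @ B)" "r \<le> b" "\<forall>z\<in>set A'. z \<le> b"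
      by auto
    consider "a < y" | "a = y" | "y < a" by linarith
    then show ?case
    proof cases
      case 1
      then show ?thesis using Cons.prems assms(1)
        by (intro exI[of _ y] exI[of _ "a # A @ [b]"]) auto
    next
      case 2
      then show ?thesis using Cons.prems
        by (intro exI[of _ "Suc a"] exI[of _ "y # A @ [b]"]) auto
    next
      case 3
      then show ?thesis using Cons.prems *
        by (intro exI[of _ r] exI[of _ "y # A'"]) auto
    qed
  qed
  then show ?thesis using that by blast
qed

text \<open>Once b is in the row, a acts only up to b and c only beyond b, so the two insertions
  commute. The bumped letters r, q, p of a, b, c satisfy r < q < p, and the outputs q r p and q p r
  differ by a move of the same kind. If c is appended, it bumps nothing and the outputs
  agree.\<close>

lemma row_ins_left:
  assumes "a < b" "b < c" "sorted_wrt (<) R"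
  shows "snd (row_ins R [b, a, c]) = snd (row_ins R [b, c, a]) \<and>
    ck_equiv (fst (row_ins R [b, a, c])) (fst (row_ins R [b, c, a]))"
proof -
  \<comment> \<open>The alternatives for q come from the two ways of bumping: a replaced entry lies
    below everything in B, and for a letter b already present q is b + 1.\<close>
  have "\<exists>ob A B. bump b R = (ob, A @ b # B) \<and> (\<forall>y\<in>set A. y < b) \<and>
      (B = [] \<or> (\<exists>q. ob = [q] \<and> b < q \<and> ((\<forall>z\<in>set B. q < z) \<or> q = Suc b)))"
    using assms(3)
    by (cases rule: bump_cases[of R b]) (fastforce simp: sorted_wrt_append)+
  then obtain ob A B where b: "bump b R = (ob, A @ b # B)" and A: "\<forall>y\<in>set A. y < b"
    and q: "B = [] \<or> (\<exists>q. ob = [q] \<and> b < q \<and> ((\<forall>z\<in>set B. q < z) \<or> q = Suc b))"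
    by blast
  obtain r A' where r: "\<forall>B. bump a (A @ b # B) = ([r], A' @ B)" "r \<le> b" "\<forall>z\<in>set A'. z \<le> b"
    by (rule bump_below[OF assms(1) A])
  obtain oc B' where c: "bump c B = (oc, B')" by fastforce
  have "\<forall>y\<in>set (A @ [b]). y < c" using A assms(2) by fastforce
  from bump_append[OF this, of B] have "bump c (A @ b # B) = (oc, A @ b # B')" using c by simp
  moreover have "bump c (A' @ B) = (oc, A' @ B')"
    using bump_append[of A' c B] r(3) assms(2) c by fastforce
  moreover have "ck_equiv (ob @ r # oc) (ob @ oc @ [r])"
  proof (cases "B = []")
    case True
    then show ?thesis using c by auto
  next
    case False
    with q obtain q where q: "ob = [q]" "b < q" "(\<forall>z\<in>set B. q < z) \<or> q = Suc b" by blast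
    have "oc = [] \<or> (\<exists>p. oc = [p] \<and> q < p)"
      using q(3) assms(2) c by (cases rule: bump_cases[of B c]) fastforce+
    then show ?thesis
      using ck_equiv_step[OF ck_step.left[of r q _ "[]" "[]"]] q(1,2) r(2) by auto
  qed
  ultimately show ?thesis using b r(1) by simp
qed

lemma bump_row:
  assumes "bump c Q = (p, Q')"
  shows "c \<in> set Q'" "set Q' \<subseteq> insert c (set Q)" "p = [] \<or> (\<exists>y. p = [y] \<and> c < y)"
  using assms by (cases rule: bump_cases[of Q c]; force)+

lemma bump_out:
  assumes "b < c" "c \<in> set X" "sorted_wrt (<) X"
  obtains r S where "bump b X = ([r], S)" "r \<le> c" "b < r" "r \<in> set X \<or> b \<in> set X"
  using assms(2,3) by (cases rule: bump_cases[of X b]) (use assms(1) in \<open>fastforce simp: sorted_wrt_append\<close>)+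

text \<open>The generic situation for the move with its witness on the right: a bumps q, c bumps p
  or nothing, and b then bumps some r with q < r \<le> c < p. Here X is the relevant part of the row
  after the insertion of c. The condition on q covers both a replaced entry, lying below X, and the
  output a + 1 of a letter already present, which is at most b.\<close>

lemma ck_equiv_outputs:
  assumes "b < c" "c \<in> set X" "sorted_wrt (<) X" "(\<forall>z\<in>set X. q < z) \<or> q \<le> b"
    "p = [] \<or> (\<exists>y. p = [y] \<and> c < y)"
  shows "ck_equiv (q # p @ fst (bump b X)) (p @ q # fst (bump b X))"
proof -
  obtain r S where r: "bump b X = ([r], S)" "r \<le> c" "b < r" "r \<in> set X \<or> b \<in> set X"
    using bump_out assms(1-3) by blast
  then have "q < r" using assms(4) by force
  then show ?thesis
    using ck_equiv_step[OF ck_step.right[of q r _ "[]" "[]"]] assms(5) r by auto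
qed

text \<open>The kind of the move need not survive on the bumped letters. If a bumps an entry q above
  c, the outputs differ by a move with its witness on the left or agree; if q = c, they are c, c +
  1, c and c + 1, c, c + 1. The remaining cases keep the kind or give equal outputs.\<close>

lemma row_ins_right:
  assumes "a < b" "b < c" "sorted_wrt (<) R"
    "a \<in> set R \<Longrightarrow> Suc a \<in> set R" "c \<in> set R \<Longrightarrow> Suc c \<in> set R"
  shows "snd (row_ins R [a, c, b]) = snd (row_ins R [c, a, b]) \<and>
    ck_equiv (fst (row_ins R [a, c, b])) (fst (row_ins R [c, a, b]))"
proof (cases rule: bump_cases[of R a])
  case append
  then have "\<forall>y\<in>set R. y < b" "\<forall>y\<in>set R. y < c" using assms(1,2) by auto
  with append assms(1,2) show ?thesis by (simp add: bump_append bump_above)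
next
  case (replace A q Q)
  have A: "\<forall>y\<in>set A. y < b" "\<forall>y\<in>set A. y < c" using replace assms(1,2) by auto
  have Q: "sorted_wrt (<) Q" "\<forall>z\<in>set Q. q < z"
    using assms(3) replace by (auto simp: sorted_wrt_append)
  consider "c < q" | "q = c" | "q < c" by linarith
  then show ?thesis
  proof cases
    case 1
    then show ?thesis
      using replace A assms(1,2) Q ck_equiv_sym[OF ck_equiv_step[OF ck_step.left[of c q _ "[]" "[]"]]]
      by (cases Q) (auto simp: bump_append)
  next
    case 2
    then obtain C where "Q = Suc c # C"
      using Suc_mem_row[of A c Q] replace assms(3,5) by auto
    then show ?thesis
      using replace A assms(1,2) 2 ck_equiv_step[OF ck_step.braid[of "[]" c "[]"]]
      by (auto simp: bump_append)
  next
    case 3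
    obtain p Q' where c: "bump c Q = (p, Q')" by fastforce
    have "sorted_wrt (<) Q'" using sorted_bump[OF Q(1), of c] c by simp
    with bump_row[OF c] Q 3 have "ck_equiv (q # p @ fst (bump b Q')) (p @ q # fst (bump b Q'))"
      by (intro ck_equiv_outputs[OF assms(2)]) auto
    then show ?thesis
      using replace A assms(1,2) 3 c by (cases "bump b Q'") (simp add: bump_append)
  qed
next
  case (mem A B)
  then obtain Q where B: "B = Suc a # Q"
    using Suc_mem_row[of A a B] assms(3,4) by auto
  have A: "\<forall>y\<in>set A. y < b" "\<forall>y\<in>set A. y < c" using mem assms(1,2) by auto
  have Q: "sorted_wrt (<) Q" "\<forall>z\<in>set Q. Suc a < z"
    using assms(3) mem B by (auto simp: sorted_wrt_append)
  obtain p Q' where c: "bump c Q = (p, Q')" by fastforce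
  have "sorted_wrt (<) Q'" using sorted_bump[OF Q(1), of c] c by simp
  with bump_row[OF c] Q assms(1,2)
  have "ck_equiv (Suc a # p @ fst (bump b (Suc a # Q'))) (p @ Suc a # fst (bump b (Suc a # Q')))"
    by (intro ck_equiv_outputs[OF assms(2)]) auto
  then show ?thesis
    using mem B A assms(1,2) c by (cases "bump b Q'") (auto simp: bump_append)
qed

text \<open>If a + 1 is in the row, so is a + 2, and the outputs form the braid on a + 1 and a + 2.
  Otherwise they agree or differ by a move with its witness on the left.\<close>

lemma row_ins_braid:
  assumes "sorted_wrt (<) R"
    "a \<in> set R \<Longrightarrow> Suc a \<in> set R" "Suc a \<in> set R \<Longrightarrow> Suc (Suc a) \<in> set R"
  shows "snd (row_ins R [a, Suc a, a]) = snd (row_ins R [Suc a, a, Suc a]) \<and>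
    ck_equiv (fst (row_ins R [a, Suc a, a])) (fst (row_ins R [Suc a, a, Suc a]))"
proof (cases rule: bump_cases[of R a])
  case append
  then have "\<forall>y\<in>set R. y < Suc a" by auto
  with append show ?thesis by (simp add: bump_append bump_above)
next
  case (replace A q Q)
  have A: "\<forall>y\<in>set A. y < Suc a" using replace by auto
  have Q: "\<forall>z\<in>set Q. q < z"
    using assms(1) replace by (auto simp: sorted_wrt_append)
  show ?thesis
  proof (cases "q = Suc a")
    case True
    then obtain C where "Q = Suc (Suc a) # C"
      using Suc_mem_row[of A "Suc a" Q] replace assms(1,3) by auto
    then show ?thesis
      using replace A True ck_equiv_step[OF ck_step.braid[of "[]" "Suc a" "[]"]]
      by (auto simp: bump_append)
  next
    case False
    then show ?thesis
      using replace A Q ck_equiv_sym[OF ck_equiv_step[OF ck_step.left[of "Suc a" q _ "[]" "[]"]]]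
      by (cases Q) (auto simp: bump_append)
  qed
next
  case (mem A B)
  then obtain Q where B: "B = Suc a # Q"
    using Suc_mem_row[of A a B] assms(1,2) by auto
  then obtain C where "Q = Suc (Suc a) # C"
    using Suc_mem_row[of "A @ [a]" "Suc a" Q] assms(1,3) mem by auto
  moreover have "\<forall>y\<in>set A. y < Suc a" using mem by auto
  ultimately show ?thesis
    using mem B ck_equiv_step[OF ck_step.braid[of "[]" "Suc a" "[]"]] ck_equiv_sym
    by (auto simp: bump_append)
qed

text \<open>Everything takes place in the three-letter window: the letters before it produce the
  same row S, and equal rows after it treat the remaining letters alike.\<close>

lemma row_ins_ck_step:
  assumes "sorted_wrt (<) R" "reduced_word (R @ w)" "ck_step w w'"
  shows "snd (row_ins R w) = snd (row_ins R w') \<and>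
    ck_equiv (fst (row_ins R w)) (fst (row_ins R w'))"
proof -
  have *: "snd (row_ins R (u @ t @ v)) = snd (row_ins R (u @ t' @ v)) \<and>
      ck_equiv (fst (row_ins R (u @ t @ v))) (fst (row_ins R (u @ t' @ v)))"
    if "snd (row_ins (snd (row_ins R u)) t) = snd (row_ins (snd (row_ins R u)) t') \<and>
      ck_equiv (fst (row_ins (snd (row_ins R u)) t)) (fst (row_ins (snd (row_ins R u)) t'))"
    for u v t t'
    using that by (auto simp: row_ins_append split: prod.splits intro: ck_equiv_context)
  have S: "sorted_wrt (<) (snd (row_ins R u)) \<and>
      (x \<in> set (snd (row_ins R u)) \<longrightarrow> Suc x \<in> set (snd (row_ins R u)))"
    if "reduced_word (R @ u @ x # v)" for u x v
  proof -
    obtain p S where u: "row_ins R u = (p, S)" by fastforce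
    have "reduced_word (R @ u)"
      using that reduced_word_appendD1[of "R @ u" "x # v"] by simp
    from row_ins_ck_equiv[OF assms(1) this u]
    have "ck_equiv (R @ u) (p @ S)" and S: "sorted_wrt (<) S" .
    then have "ck_equiv (R @ u @ x # v) (p @ (S @ [x]) @ v)"
      using ck_equiv_append_right[of "R @ u" "p @ S" "x # v"] by simp
    then have "reduced_word (S @ [x])"
      using that reduced_word_ck_equiv reduced_word_appendD1 reduced_word_appendD2 by metis
    with S reduced_row_Suc_mem u show ?thesis by auto
  qed
  \<comment> \<open>Both words are used: the condition on a letter concerns its insertion into S
    directly after u, and in the \<open>right\<close> and \<open>braid\<close> moves each of the two
    words starts its window with a different letter.\<close>
  have red': "reduced_word (R @ w')"
    using assms(2,3) ck_equiv_step ck_equiv_append_left reduced_word_ck_equiv by blast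
  from assms(3) show ?thesis
  proof cases
    case (left a b c u v)
    show ?thesis
      unfolding left(1,2)
      by (intro * row_ins_left left(3,4)) (use S[of u b] assms(2) left(1) in auto)
  next
    case (right a b c u v)
    show ?thesis
      unfolding right(1,2)
      by (intro * row_ins_right right(3,4))
        (use S[of u a] S[of u c] assms(2) red' right(1,2) in auto)
  next
    case (braid u a v)
    show ?thesis
      unfolding braid
      by (intro * row_ins_braid) (use S[of u a] S[of u "Suc a"] assms(2) red' braid in auto)
  qed
qed

lemma row_ins_ck_equiv_invariant:
  assumes "ck_equiv w w'" "reduced_word w"
  shows "snd (row_ins [] w) = snd (row_ins [] w') \<and>
    ck_equiv (fst (row_ins [] w)) (fst (row_ins [] w'))"
  using assms
proof (induction rule: ck_equiv_induct)
  case (step y z)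
  then have "reduced_word ([] @ y)" "reduced_word ([] @ z)"
    using reduced_word_ck_equiv ck_equiv_step by fastforce+
  with step(2) have "snd (row_ins [] y) = snd (row_ins [] z) \<and>
      ck_equiv (fst (row_ins [] y)) (fst (row_ins [] z))"
    using row_ins_ck_step[of "[]" y z] row_ins_ck_step[of "[]" z y] ck_equiv_sym by auto
  with step show ?case using ck_equiv_trans by metis
qed simp

section \<open>Insertion of tableau words and uniqueness of the tableau\<close>

lemma row_ins_above:
  "sorted_wrt (<) (R @ w) \<Longrightarrow> row_ins R w = ([], R @ w)"
proof (induction w arbitrary: R)
  case (Cons x w)
  then have "bump x R = ([], R @ [x])"
    by (simp add: bump_above sorted_wrt_append)
  with Cons show ?case by simp
qed simp

text \<open>Each inserted letter replaces the one above it and then joins the prefix A that the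
  following letters pass over; the induction varies A for this reason.\<close>

lemma row_ins_block:
  assumes "length \<tau> = length \<sigma>" "\<forall>j<length \<sigma>. \<sigma> ! j < \<tau> ! j" "sorted_wrt (<) (A @ \<sigma>)"
  shows "row_ins (A @ \<tau> @ C) \<sigma> = (\<tau>, A @ \<sigma> @ C)"
  using assms
proof (induction \<tau> \<sigma> arbitrary: A rule: list_induct2)
  case (Cons t \<tau> s \<sigma>)
  have st: "s < t" and *: "\<forall>j<length \<sigma>. \<sigma> ! j < \<tau> ! j" using Cons.prems(1) by force+
  have "bump s (A @ t # \<tau> @ C) = ([t], A @ s # \<tau> @ C)"
    using bump_append[of A s] Cons.prems(2) st by (simp add: sorted_wrt_append)
  with Cons.IH[OF *, of "A @ [s]"] Cons.prems(2) show ?case by simp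
qed simp

lemma increasing_young_tableau_ConsD:
  "increasing_young_tableau (r # T) \<Longrightarrow> increasing_young_tableau T"
  by (force simp: increasing_young_tableau_def)

text \<open>The word of the rows above r leaves its bottom row s behind. Since columns increase, the
  letters of r replace those of s one for one; as r is at least as long, all of s is bumped and the
  rest of r is appended.\<close>

lemma row_ins_reading_word:
  "increasing_young_tableau (r # T) \<Longrightarrow>
     row_ins [] (row_reading_word (r # T)) = (row_reading_word T, r)"
proof (induction T arbitrary: r)
  case Nil
  then show ?case
    using row_ins_above[of "[]" r] by (simp add: row_reading_word_def increasing_young_tableau_def)
next
  case (Cons s T)
  have sorted: "sorted_wrt (<) r"
    and le: "length s \<le> length r" and less: "\<forall>j<length s. r ! j < s ! j"
    using Cons.prems by (force simp: increasing_young_tableau_def)+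
  have "row_ins s (take (length s) r) = (s, take (length s) r)"
    using row_ins_block[of s "take (length s) r" "[]" "[]"] sorted le less
    by (simp add: sorted_wrt_take)
  then have "row_ins s r = (s, r)"
    using row_ins_append[of s "take (length s) r" "drop (length s) r"]
      row_ins_above[of "take (length s) r" "drop (length s) r"] sorted by simp
  with Cons.IH[OF increasing_young_tableau_ConsD[OF Cons.prems]] show ?case
    using row_ins_append[of "[]" "row_reading_word (s # T)" r] by (simp add: row_reading_word_def)
qed

text \<open>Empty rows leave no trace in a reading word; the conditions excluding them make the word
  determine the array itself.\<close>

lemma tableau_unique:
  assumes "increasing_young_tableau T" "increasing_young_tableau T'"
    "[] \<notin> set T" "[] \<notin> set T'" "reduced_word (row_reading_word T)"
    "ck_equiv (row_reading_word T) (row_reading_word T')"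
  shows "T = T'"
  using assms
proof (induction T arbitrary: T')
  case Nil
  then show ?case
    using ck_equiv_invariants[OF Nil.prems(6)]
    by (cases T' rule: rev_cases) (auto simp: row_reading_word_def)
next
  case (Cons r T)
  then have "T' \<noteq> []"
    using ck_equiv_invariants[OF Cons.prems(6)]
    by (auto simp: row_reading_word_def)
  then obtain r' S where T': "T' = r' # S" by (cases T') auto
  have eq: "r = r'" "ck_equiv (row_reading_word T) (row_reading_word S)"
    using row_ins_ck_equiv_invariant[OF Cons.prems(6,5)] Cons.prems(1,2)
    by (simp_all add: T' row_ins_reading_word)
  have "reduced_word (row_reading_word T)"
    using Cons.prems(5) reduced_word_appendD1 by (simp add: row_reading_word_def)
  with Cons.IH[of S] Cons.prems eq increasing_young_tableau_ConsD T' show ?case by auto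
qed

subsection \<open>Recursion for the drop of two rows\<close>

text \<open>The parameter \<open>f\<close> computes the bottom entries of the initial block; with
  \<open>f = hat_block x\<close> this describes the alignment to the right of a free letter \<open>x\<close>, which makes
  the operation recursive in the first free letter.\<close>

definition drop_rows_with ::
  "(nat list \<Rightarrow> nat list \<Rightarrow> nat list) \<Rightarrow> nat list \<Rightarrow> nat list \<Rightarrow> nat list \<times> nat list" where
  "drop_rows_with f \<tau> \<sigma> =
     (let k = length (drop_free \<tau> \<sigma>) in
      (concat (map (top_block \<tau> \<sigma>) [0..<k + 1]),
       f (top_block \<tau> \<sigma> 0) (bottom_block \<tau> \<sigma> 0) @
       concat (map (\<lambda>j. drop_letter \<tau> \<sigma> j #
                 hat_block (drop_letter \<tau> \<sigma> j) (top_block \<tau> \<sigma> j) (bottom_block \<tau> \<sigma> j))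
               [1..<k + 1]) @
       right_block \<tau> \<sigma>))"

lemma drop_rows_eq_with: "drop_rows = drop_rows_with (\<lambda>_ b. b)"
  by (simp add: fun_eq_iff drop_rows_def drop_rows_with_def)

lemma upt_shift: "[a + n..<b + n] = map (\<lambda>i. i + n) [a..<b]" for n :: nat
  by (induction b) auto

lemma map_nth_take: "n \<le> length xs \<Longrightarrow> map (\<lambda>c. xs ! (c - 1)) [1..<n + 1] = take n xs"
  by (simp add: list_eq_iff_nth_eq del: upt_Suc)

lemma map_nth_upt_take: "n \<le> length xs \<Longrightarrow> map ((!) xs) [0..<n] = take n xs"
  by (rule nth_equalityI) simp_all

lemma map_nth_upt_drop: "map ((!) xs) [n..<length xs] = drop n xs"
  by (rule nth_equalityI) simp_all

lemma concat_map_if: "concat (map (\<lambda>i. if P i then [f i] else []) xs) = map f (filter P xs)"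
  by (induction xs) auto

lemma bottom_block_filter:
  "bottom_block \<tau> \<sigma> j =
     map ((!) \<sigma>) (filter (\<lambda>i. drop_bounds \<tau> \<sigma> ! j < drop_cols \<tau> \<sigma> ! i \<and>
        drop_cols \<tau> \<sigma> ! i < drop_bounds \<tau> \<sigma> ! (j + 1)) [0..<length \<sigma>])"
  by (simp add: bottom_block_def concat_map_if)

lemma right_block_filter:
  "right_block \<tau> \<sigma> =
     map ((!) \<sigma>) (filter (\<lambda>i. length \<tau> < drop_cols \<tau> \<sigma> ! i) [0..<length \<sigma>])"
  by (simp add: right_block_def concat_map_if)

lemma filter_upt_less: "filter (\<lambda>i. i < n) [0..<m] = [0..<min m n]" for n :: nat
  by (induction m) auto

lemma filter_upt_ge: "filter (\<lambda>i. n \<le> i) [0..<m] = [n..<m]" for n :: nat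
  by (induction m) auto

text \<open>One formula for two situations. If \<sigma> is the shorter row, the surplus letters of
  \<tau> are free and fall; if it is the longer one, nothing is free and its surplus forms the right
  block. At least one of the two \<open>drop\<close> terms is empty.\<close>

lemma drop_rows_with_fits:
  assumes "\<forall>j < min (length \<sigma>) (length \<tau>). \<tau> ! j > \<sigma> ! j"
  shows "drop_rows_with f \<tau> \<sigma> =
    (take (length \<sigma>) \<tau>,
     f (take (length \<sigma>) \<tau>) (take (length \<tau>) \<sigma>) @ drop (length \<sigma>) \<tau> @ drop (length \<tau>) \<sigma>)"
proof -
  let ?s = "length \<sigma>" and ?t = "length \<tau>"
  have cols: "drop_cols \<tau> \<sigma> = [1..<?s + 1]"
    using assms by (subst drop_cols.simps) simp
  have free: "drop_free \<tau> \<sigma> = [?s + 1..<?t + 1]"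
  proof -
    have "filter (\<lambda>c. c \<notin> set [1..<?s + 1]) [1..<?t + 1] = filter (\<lambda>c. ?s < c) [0..<?t + 1]"
      by (subst upt_conv_Cons[of 0 "?t + 1"]) (auto intro!: filter_cong)
    then show ?thesis using filter_upt_ge[of "?s + 1" "?t + 1"]
      by (simp add: drop_free_def cols Suc_le_eq)
  qed
  show ?thesis
  proof (cases "?s \<le> ?t")
    case True
    then have bounds: "drop_bounds \<tau> \<sigma> = 0 # [?s + 1..<?t + 2]"
      by (simp add: drop_bounds_def free)
    have bounds_nth: "drop_bounds \<tau> \<sigma> ! 0 = 0"
      "\<And>i. i \<le> ?t - ?s \<Longrightarrow> drop_bounds \<tau> \<sigma> ! Suc i = ?s + 1 + i"
      using True by (auto simp: bounds nth_upt simp del: upt_Suc)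
    have top0: "top_block \<tau> \<sigma> 0 = take ?s \<tau>"
      using map_nth_take[OF True] bounds_nth(2)[of 0] by (simp add: top_block_def bounds_nth(1))
    have bottom0: "bottom_block \<tau> \<sigma> 0 = \<sigma>"
      using bounds_nth(2)[of 0]
      by (simp add: bottom_block_filter bounds_nth(1) cols filter_id_conv map_nth
          cong: filter_cong del: upt_Suc)
    have top: "top_block \<tau> \<sigma> (Suc i) = []" and bottom: "bottom_block \<tau> \<sigma> (Suc i) = []"
      and letter: "drop_letter \<tau> \<sigma> (Suc i) = \<tau> ! (?s + i)" if "i < ?t - ?s" for i
      using that bounds_nth(2)[of i] bounds_nth(2)[of "Suc i"]
      by (auto simp: top_block_def bottom_block_filter drop_letter_def filter_empty_conv)
    have right: "right_block \<tau> \<sigma> = []"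
      using True by (simp add: right_block_filter cols filter_empty_conv del: upt_Suc)
    \<comment> \<open>The free letters are consecutive here and enclose only empty blocks.\<close>
    have hat: "hat_block x [] [] = []" for x by (simp add: hat_block_def)
    have k: "length (drop_free \<tau> \<sigma>) = ?t - ?s" by (simp add: free del: upt_Suc)
    have upt: "[1..<?t - ?s + 1] = map Suc [0..<?t - ?s]"
      by (simp add: map_Suc_upt)
    have upt0: "[0..<?t - ?s + 1] = 0 # map Suc [0..<?t - ?s]"
      using upt by (simp add: upt_conv_Cons del: upt_Suc)
    have tops: "concat (map (top_block \<tau> \<sigma>) [0..<?t - ?s + 1]) = take ?s \<tau>"
      unfolding upt0 using top by (simp add: top0)
    have letters: "map (\<lambda>j. drop_letter \<tau> \<sigma> j #
        hat_block (drop_letter \<tau> \<sigma> j) (top_block \<tau> \<sigma> j) (bottom_block \<tau> \<sigma> j))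
        [1..<?t - ?s + 1] = map (\<lambda>i. [\<tau> ! (?s + i)]) [0..<?t - ?s]"
      unfolding upt map_map comp_def
      by (rule map_cong[OF refl]) (simp add: top bottom letter hat)
    have "map (\<lambda>i. \<tau> ! (?s + i)) [0..<?t - ?s] = drop ?s \<tau>"
      using True by (simp add: list_eq_iff_nth_eq)
    then have rest: "concat (map (\<lambda>i. [\<tau> ! (?s + i)]) [0..<?t - ?s]) = drop ?s \<tau>"
      by (simp only: concat_map_singleton)
    show ?thesis
      unfolding drop_rows_with_def k Let_def tops letters rest top0 bottom0 right
      using True by simp
  next
    case False
    then have free: "drop_free \<tau> \<sigma> = []" by (simp add: free)
    then have bounds: "drop_bounds \<tau> \<sigma> = [0, ?t + 1]" by (simp add: drop_bounds_def)
    have "top_block \<tau> \<sigma> 0 = \<tau>"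
      using map_nth_take[of ?t \<tau>] by (simp add: top_block_def bounds)
    moreover have "bottom_block \<tau> \<sigma> 0 = take ?t \<sigma>"
    proof -
      have "filter (\<lambda>i. 0 < [1..<?s + 1] ! i \<and> [1..<?s + 1] ! i < ?t + 1) [0..<?s] =
          filter (\<lambda>i. i < ?t) [0..<?s]"
        by (rule filter_cong) (auto simp del: upt_Suc)
      also have "\<dots> = [0..<?t]" using False filter_upt_less[of ?t ?s] by simp
      finally show ?thesis using False
        unfolding bottom_block_filter bounds cols by (simp add: map_nth_upt_take del: upt_Suc)
    qed
    moreover have "right_block \<tau> \<sigma> = drop ?t \<sigma>"
    proof -
      have "filter (\<lambda>i. ?t < [1..<?s + 1] ! i) [0..<?s] = filter (\<lambda>i. ?t \<le> i) [0..<?s]"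
        by (rule filter_cong) (auto simp del: upt_Suc)
      then show ?thesis
        unfolding right_block_filter cols by (simp only: filter_upt_ge map_nth_upt_drop)
    qed
    ultimately show ?thesis
      using False by (simp add: drop_rows_with_def free)
  qed
qed

lemma drop_cols_violation:
  assumes "j < min (length \<sigma>) (length \<tau>)" "\<tau> ! j \<le> \<sigma> ! j" "\<forall>i<j. \<sigma> ! i < \<tau> ! i"
  shows "drop_cols \<tau> \<sigma> = [1..<j + 1] @ map (\<lambda>c. c + (j + 1)) (drop_cols (drop (j + 1) \<tau>) (drop j \<sigma>))"
proof -
  have "(LEAST j. j < min (length \<sigma>) (length \<tau>) \<and> \<tau> ! j \<le> \<sigma> ! j) = j"
    using assms by (intro Least_equality) (auto simp: not_less[symmetric])
  moreover have "\<not> (\<forall>j < min (length \<sigma>) (length \<tau>). \<tau> ! j > \<sigma> ! j)"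
    using assms by (auto simp: not_less)
  ultimately show ?thesis
    unfolding drop_cols.simps[of \<tau> \<sigma>] Let_def by (simp only: if_False)
qed

lemma first_violation:
  fixes \<tau> \<sigma> :: "nat list"
  assumes "\<not> (\<forall>j < min (length \<sigma>) (length \<tau>). \<tau> ! j > \<sigma> ! j)"
  obtains j where "j < min (length \<sigma>) (length \<tau>)" "\<tau> ! j \<le> \<sigma> ! j" "\<forall>i<j. \<sigma> ! i < \<tau> ! i"
proof -
  let ?P = "\<lambda>j. j < min (length \<sigma>) (length \<tau>) \<and> \<tau> ! j \<le> \<sigma> ! j"
  have "\<exists>j. ?P j" using assms by (auto simp: not_less)
  then obtain j where j: "?P j" "\<forall>i<j. \<not> ?P i"
    using exists_least_iff[of ?P] by blast
  show ?thesis
  proof (rule that)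
    show "\<forall>i<j. \<sigma> ! i < \<tau> ! i" using j by auto
  qed (use j in auto)
qed

lemma drop_cols_length_pos: "length (drop_cols \<tau> \<sigma>) = length \<sigma> \<and> (\<forall>c\<in>set (drop_cols \<tau> \<sigma>). 0 < c)"
proof (induction \<tau> arbitrary: \<sigma> rule: length_induct)
  case (1 \<tau>)
  show ?case
  proof (cases "\<forall>j < min (length \<sigma>) (length \<tau>). \<tau> ! j > \<sigma> ! j")
    case True
    then show ?thesis by (subst (1 2) drop_cols.simps) (auto simp del: upt_Suc)
  next
    case False
    then obtain j where j: "j < min (length \<sigma>) (length \<tau>)" "\<tau> ! j \<le> \<sigma> ! j" "\<forall>i<j. \<sigma> ! i < \<tau> ! i"
      by (rule first_violation)
    then have "length (drop (j + 1) \<tau>) < length \<tau>" by auto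
    then have "length (drop_cols (drop (j + 1) \<tau>) (drop j \<sigma>)) = length (drop j \<sigma>)"
      using 1 by blast
    with j show ?thesis by (auto simp: drop_cols_violation[OF j])
  qed
qed

text \<open>Cutting after the first free column j + 1 removes j + 1 letters of \<tau> but only j
  letters of \<sigma>, hence the two different shifts. The free letter \<open>\<tau> ! j\<close>
  stands immediately left of what remains, so the initial block there is treated by
  \<open>hat_block (\<tau> ! j)\<close>.\<close>

lemma drop_rows_with_violation:
  assumes j: "j < min (length \<sigma>) (length \<tau>)" "\<tau> ! j \<le> \<sigma> ! j" "\<forall>i<j. \<sigma> ! i < \<tau> ! i"
  shows "drop_rows_with f \<tau> \<sigma> =
    (case drop_rows_with (hat_block (\<tau> ! j)) (drop (j + 1) \<tau>) (drop j \<sigma>) of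
       (T, B) \<Rightarrow> (take j \<tau> @ T, f (take j \<tau>) (take j \<sigma>) @ \<tau> ! j # B))"
proof -
  define \<tau>' where "\<tau>' = drop (j + 1) \<tau>"
  define \<sigma>' where "\<sigma>' = drop j \<sigma>"
  let ?c = "drop_cols \<tau>' \<sigma>'" and ?n = "j + 1"
  have len: "length \<tau> = length \<tau>' + ?n" "length \<sigma> = length \<sigma>' + j"
    using j(1) by (auto simp: \<tau>'_def \<sigma>'_def)
  have nth: "\<tau> ! (i + ?n) = \<tau>' ! i" "\<sigma> ! (i + j) = \<sigma>' ! i" for i
    using j(1) by (simp_all add: \<tau>'_def \<sigma>'_def add.commute)
  have c: "length ?c = length \<sigma>'" "\<forall>x\<in>set ?c. 0 < x"
    using drop_cols_length_pos by auto
  have cols: "drop_cols \<tau> \<sigma> = [1..<?n] @ map (\<lambda>x. x + ?n) ?c"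
    using drop_cols_violation[OF j] by (simp add: \<tau>'_def \<sigma>'_def)
  have cols_nth: "i < j \<Longrightarrow> drop_cols \<tau> \<sigma> ! i = i + 1"
    "i < length \<sigma>' \<Longrightarrow> drop_cols \<tau> \<sigma> ! (i + j) = ?c ! i + ?n"
    "j \<le> i \<Longrightarrow> i < length \<sigma>' + j \<Longrightarrow> drop_cols \<tau> \<sigma> ! i = ?c ! (i - j) + ?n" for i
    using c(1) by (auto simp: cols nth_append simp del: upt_Suc)
  have free: "drop_free \<tau> \<sigma> = ?n # map (\<lambda>x. x + ?n) (drop_free \<tau>' \<sigma>')"
  proof -
    have upt: "[1..<length \<tau> + 1] = [1..<?n] @ ?n # map (\<lambda>x. x + ?n) [1..<length \<tau>' + 1]"
      using upt_add_eq_append[of 1 ?n "length \<tau>' + 1"] upt_shift[of 1 ?n "length \<tau>' + 1"]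
      by (simp add: len add.commute add.left_commute upt_conv_Cons del: upt_Suc)
    have 1: "filter (\<lambda>x. x \<notin> set (drop_cols \<tau> \<sigma>)) [1..<?n] = []"
      by (auto simp: cols filter_empty_conv)
    have 2: "?n \<notin> set (drop_cols \<tau> \<sigma>)"
      using c(2) by (auto simp: cols)
    have 3: "x + ?n \<in> set (drop_cols \<tau> \<sigma>) \<longleftrightarrow> x \<in> set ?c" if "0 < x" for x
      using that by (auto simp: cols)
    have 4: "filter (\<lambda>x. x \<notin> set (drop_cols \<tau> \<sigma>)) (map (\<lambda>x. x + ?n) [1..<length \<tau>' + 1]) =
        map (\<lambda>x. x + ?n) (drop_free \<tau>' \<sigma>')"
      unfolding drop_free_def filter_map comp_def
      by (intro arg_cong[of _ _ "map _"] filter_cong refl) (use 3 in \<open>auto simp del: upt_Suc\<close>)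
    show ?thesis
      unfolding drop_free_def[of \<tau> \<sigma>] upt filter_append by (simp only: 1 4 filter.simps 2) simp
  qed
  \<comment> \<open>After the shift, the left sentinel 0 of the shorter alignment becomes the column
    of the first free letter.\<close>
  have bounds: "drop_bounds \<tau> \<sigma> = 0 # map (\<lambda>x. x + ?n) (drop_bounds \<tau>' \<sigma>')"
    by (simp add: drop_bounds_def free len)
  define k where "k = length (drop_free \<tau>' \<sigma>')"
  have length_bounds: "length (drop_bounds \<tau>' \<sigma>') = k + 2"
    by (simp add: drop_bounds_def k_def)
  have bounds_nth: "drop_bounds \<tau> \<sigma> ! 0 = 0"
    "i \<le> k + 1 \<Longrightarrow> drop_bounds \<tau> \<sigma> ! Suc i = drop_bounds \<tau>' \<sigma>' ! i + ?n" for i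
    using length_bounds by (simp_all add: bounds)
  have bounds0: "drop_bounds \<tau>' \<sigma>' ! 0 = 0" by (simp add: drop_bounds_def)
  have bounds_pos: "0 < drop_bounds \<tau>' \<sigma>' ! Suc i" if "i \<le> k" for i
  proof -
    have "drop_bounds \<tau>' \<sigma>' ! Suc i \<in> set (drop_free \<tau>' \<sigma>' @ [length \<tau>' + 1])"
      using that by (simp add: drop_bounds_def k_def del: set_append)
    then show ?thesis by (auto simp: drop_free_def)
  qed
  have upt_\<sigma>: "[0..<length \<sigma>] = [0..<j] @ map (\<lambda>i. i + j) [0..<length \<sigma>']"
    using upt_add_eq_append[of 0 j "length \<sigma>'"] upt_shift[of 0 j "length \<sigma>'"]
    by (simp add: len add.commute)
  have top0: "top_block \<tau> \<sigma> 0 = take j \<tau>"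
    using map_nth_take[of j \<tau>] j(1) bounds_nth(2)[of 0]
    by (simp add: top_block_def bounds_nth(1) bounds0)
  have top: "top_block \<tau> \<sigma> (Suc i) = top_block \<tau>' \<sigma>' i" if "i \<le> k" for i
  proof -
    have "map (\<lambda>c. \<tau> ! (c - 1)) [drop_bounds \<tau>' \<sigma>' ! i + 1 + ?n..<drop_bounds \<tau>' \<sigma>' ! (i + 1) + ?n] =
        map (\<lambda>c. \<tau>' ! (c - 1)) [drop_bounds \<tau>' \<sigma>' ! i + 1..<drop_bounds \<tau>' \<sigma>' ! (i + 1)]"
      unfolding upt_shift map_map comp_def
    proof (rule map_cong[OF refl])
      fix x assume "x \<in> set [drop_bounds \<tau>' \<sigma>' ! i + 1..<drop_bounds \<tau>' \<sigma>' ! (i + 1)]"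
      then have "x + ?n - 1 = (x - 1) + ?n" by auto
      then show "\<tau> ! (x + ?n - 1) = \<tau>' ! (x - 1)" by (simp only: nth)
    qed
    then show ?thesis
      using bounds_nth(2)[of i] bounds_nth(2)[of "Suc i"] that by (simp add: top_block_def)
  qed
  have bottom0: "bottom_block \<tau> \<sigma> 0 = take j \<sigma>"
  proof -
    have "filter (\<lambda>i. 0 < drop_cols \<tau> \<sigma> ! i \<and> drop_cols \<tau> \<sigma> ! i < ?n) [0..<length \<sigma>] = [0..<j]"
      unfolding upt_\<sigma> filter_append
      using cols_nth(3) by (auto simp: filter_id_conv filter_empty_conv cols_nth(1))
    then show ?thesis
      using bounds_nth(2)[of 0] j(1)
      by (simp add: bottom_block_filter bounds_nth(1) bounds0 map_nth_upt_take)
  qed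
  have bottom: "bottom_block \<tau> \<sigma> (Suc i) = bottom_block \<tau>' \<sigma>' i" if "i \<le> k" for i
  proof -
    have "filter (\<lambda>l. drop_bounds \<tau>' \<sigma>' ! i + ?n < drop_cols \<tau> \<sigma> ! l \<and>
          drop_cols \<tau> \<sigma> ! l < drop_bounds \<tau>' \<sigma>' ! (i + 1) + ?n) [0..<length \<sigma>] =
        map (\<lambda>i. i + j) (filter (\<lambda>l. drop_bounds \<tau>' \<sigma>' ! i < ?c ! l \<and> ?c ! l < drop_bounds \<tau>' \<sigma>' ! (i + 1))
          [0..<length \<sigma>'])"
      (is "filter ?P _ = map _ (filter ?Q _)")
    proof -
      have "filter ?P [0..<j] = []" by (auto simp: filter_empty_conv cols_nth(1))
      moreover have "filter (\<lambda>l. ?P (l + j)) [0..<length \<sigma>'] = filter ?Q [0..<length \<sigma>']"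
        by (rule filter_cong) (simp_all add: cols_nth(2))
      ultimately show ?thesis
        unfolding upt_\<sigma> filter_append filter_map comp_def by simp
    qed
    then show ?thesis
      using bounds_nth(2)[of i] bounds_nth(2)[of "Suc i"] that
      by (simp add: bottom_block_filter nth comp_def)
  qed
  have right: "right_block \<tau> \<sigma> = right_block \<tau>' \<sigma>'"
  proof -
    have "filter (\<lambda>l. length \<tau> < drop_cols \<tau> \<sigma> ! l) [0..<length \<sigma>] =
        map (\<lambda>i. i + j) (filter (\<lambda>l. length \<tau>' < ?c ! l) [0..<length \<sigma>'])"
      (is "filter ?P _ = map _ (filter ?Q _)")
    proof -
      have "filter ?P [0..<j] = []" by (auto simp: filter_empty_conv cols_nth(1) len)
      moreover have "filter (\<lambda>l. ?P (l + j)) [0..<length \<sigma>'] = filter ?Q [0..<length \<sigma>']"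
        by (rule filter_cong) (simp_all add: cols_nth(2) len)
      ultimately show ?thesis
        unfolding upt_\<sigma> filter_append filter_map comp_def by simp
    qed
    then show ?thesis by (simp add: right_block_filter nth comp_def)
  qed
  have letter1: "drop_letter \<tau> \<sigma> (Suc 0) = \<tau> ! j"
    using bounds_nth(2)[of 0] by (simp add: drop_letter_def bounds0)
  have letter: "drop_letter \<tau> \<sigma> (Suc (Suc i)) = drop_letter \<tau>' \<sigma>' (Suc i)" if "i \<le> k" for i
  proof -
    have "drop_bounds \<tau>' \<sigma>' ! Suc i + ?n - 1 = (drop_bounds \<tau>' \<sigma>' ! Suc i - 1) + ?n"
      using bounds_pos[OF that] by simp
    then show ?thesis
      using bounds_nth(2)[of "Suc i"] that by (simp only: drop_letter_def nth)
  qed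
  have len_free: "length (drop_free \<tau> \<sigma>) = Suc k" by (simp add: free k_def)
  have upt0: "[0..<Suc k + 1] = 0 # map Suc [0..<k + 1]"
    by (simp add: map_Suc_upt upt_conv_Cons del: upt_Suc)
  have upt1: "[1..<Suc k + 1] = Suc 0 # map Suc [1..<k + 1]"
    by (simp add: map_Suc_upt upt_conv_Cons del: upt_Suc)
  let ?g = "\<lambda>\<tau> \<sigma> j. drop_letter \<tau> \<sigma> j #
      hat_block (drop_letter \<tau> \<sigma> j) (top_block \<tau> \<sigma> j) (bottom_block \<tau> \<sigma> j)"
  have tops: "map (top_block \<tau> \<sigma>) [0..<Suc k + 1] = take j \<tau> # map (top_block \<tau>' \<sigma>') [0..<k + 1]"
    unfolding upt0 by (simp add: top0 top del: upt_Suc)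
  have "map (?g \<tau> \<sigma>) (map Suc [1..<k + 1]) = map (?g \<tau>' \<sigma>') [1..<k + 1]"
    unfolding map_map comp_def
  proof (rule map_cong[OF refl])
    fix i assume "i \<in> set [1..<k + 1]"
    then have "1 \<le> i \<and> i < k + 1" by (simp del: upt_Suc)
    then obtain i' where "i = Suc i'" "i' < k" by (cases i) auto
    then show "?g \<tau> \<sigma> (Suc i) = ?g \<tau>' \<sigma>' i" by (simp add: top bottom letter)
  qed
  then have gs: "map (?g \<tau> \<sigma>) [1..<Suc k + 1] =
      (\<tau> ! j # hat_block (\<tau> ! j) (top_block \<tau>' \<sigma>' 0) (bottom_block \<tau>' \<sigma>' 0)) #
      map (?g \<tau>' \<sigma>') [1..<k + 1]"
    unfolding upt1 by (simp add: letter1 top bottom del: upt_Suc)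
  show ?thesis
    unfolding drop_rows_with_def Let_def len_free tops gs top0 bottom0 right
      \<tau>'_def[symmetric] \<sigma>'_def[symmetric] k_def[symmetric]
    by simp
qed

subsection \<open>Drop as row insertion\<close>

lemma hat_block_no_hat: "\<tau> = [] \<or> \<tau> ! 0 \<noteq> Suc x \<Longrightarrow> hat_block x \<tau> \<sigma> = \<sigma>"
  by (auto simp: hat_block_def hat_count_def)

lemma set_hat_block: "set (hat_block x \<tau> \<sigma>) \<subseteq> set \<sigma> \<union> Suc ` set \<sigma>"
  by (auto simp: hat_block_def dest: in_set_takeD in_set_dropD)

text \<open>With x + 1 above x in the first column, x + 1 takes over the part of the free letter for
  the remaining columns. This is the recursion that insertion follows when it meets a letter already
  present.\<close>

lemma hat_count_Cons:
  assumes "length \<tau> = length \<sigma>" "\<forall>j<length \<sigma>. \<sigma> ! j < \<tau> ! j" "\<forall>y\<in>set \<sigma>. x < y"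
  shows "hat_count x (Suc x # \<tau>) (x # \<sigma>) = Suc (hat_count (Suc x) \<tau> \<sigma>)"
proof -
  define S where "S = {b. b \<le> length \<tau> \<and> (\<forall>i\<in>{1..b}. \<tau> ! (i - 1) = Suc x + i)}"
  have "{b. b \<le> length (Suc x # \<tau>) \<and> (\<forall>i\<in>{1..b}. (Suc x # \<tau>) ! (i - 1) = (x # \<sigma>) ! 0 + i)} =
      insert 0 (Suc ` S)" (is "?L = _")
  proof (rule set_eqI)
    fix b
    show "b \<in> ?L \<longleftrightarrow> b \<in> insert 0 (Suc ` S)"
    proof (cases b)
      case (Suc c)
      have "{1..Suc c} = insert 1 (Suc ` {1..c})"
        by (simp add: atLeastAtMost_insertL)
      then have "(\<forall>i\<in>{1..Suc c}. (Suc x # \<tau>) ! (i - 1) = x + i) \<longleftrightarrow>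
          (\<forall>i\<in>{1..c}. \<tau> ! (i - 1) = Suc x + i)"
        by (simp add: nth_Cons' del: image_Suc_atLeastAtMost)
      then show ?thesis by (auto simp: Suc S_def)
    qed simp
  qed
  moreover have S: "finite S" "0 \<in> S" by (auto simp: S_def)
  moreover have "Max (insert 0 (Suc ` S)) = Suc (Max S)"
  proof -
    have "Max (Suc ` S) = Suc (Max S)"
      using S by (subst mono_Max_commute) (auto simp: mono_def)
    moreover have "Max (insert 0 (Suc ` S)) = max 0 (Max (Suc ` S))"
      using S by (intro Max_insert) auto
    ultimately show ?thesis by simp
  qed
  ultimately have count: "hat_count x (Suc x # \<tau>) (x # \<sigma>) = Suc (Max S)"
    by (simp add: hat_count_def)
  show ?thesis
  proof (cases "\<tau> \<noteq> [] \<and> \<tau> ! 0 = Suc x + 1")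
    case True
    then have "0 < length \<sigma>" using assms(1) by auto
    \<comment> \<open>The first letter of \<sigma> is squeezed between x and x + 2, so the count for
      the remaining columns is measured from x + 1, just as in S.\<close>
    then have "\<sigma> ! 0 < \<tau> ! 0" "x < \<sigma> ! 0" using assms(2,3) by auto
    then have "\<sigma> ! 0 = Suc x" using True by simp
    with True show ?thesis
      unfolding count by (simp add: hat_count_def S_def)
  next
    case False
    have "S = {0}"
    proof (rule ccontr)
      assume "S \<noteq> {0}"
      with S obtain b where b: "b \<in> S" "0 < b" by fastforce
      then have "1 \<in> {1..b}" by simp
      with b have "\<tau> ! (1 - 1) = Suc x + 1" "\<tau> \<noteq> []" unfolding S_def by (blast, auto)
      with False show False by simp
    qed
    with False show ?thesis
      unfolding count by (auto simp: hat_count_def)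
  qed
qed

text \<open>If the next letter s equals x, reducedness makes the following entry t equal to x + 1; t
  is bumped but also stays, so its column shows s raised by 1, and t acts as the new x. As soon as s
  > x, the entry t exceeds x + 1, raising stops, and the rest is plain replacement.\<close>

lemma row_ins_hat_block:
  assumes "length \<tau> = length \<sigma>" "\<forall>j<length \<sigma>. \<sigma> ! j < \<tau> ! j" "sorted_wrt (<) \<sigma>"
    "sorted_wrt (<) (A @ x # \<tau> @ C)" "\<forall>y\<in>set \<sigma>. x \<le> y"
    "reduced_word ((A @ x # \<tau> @ C) @ \<sigma>)"
  shows "row_ins (A @ x # \<tau> @ C) \<sigma> = (\<tau>, A @ x # hat_block x \<tau> \<sigma> @ C)"
  using assms
proof (induction \<tau> \<sigma> arbitrary: A x rule: list_induct2)
  case (Cons t \<tau> s \<sigma>)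
  have st: "s < t" and less: "\<forall>j<length \<sigma>. \<sigma> ! j < \<tau> ! j" using Cons.prems(1) by force+
  show ?case
  proof (cases "s = x")
    case True
    let ?R = "A @ x # t # \<tau> @ C"
    have red: "reduced_word (?R @ [x])"
      using Cons.prems(5) reduced_word_appendD1[of "?R @ [x]" \<sigma>] True by simp
    have sorted: "sorted_wrt (<) ?R" using Cons.prems(3) by simp
    then have "Suc x \<in> set ?R" using reduced_row_Suc_mem[OF _ red] by simp
    with sorted obtain D where "t # \<tau> @ C = Suc x # D" using Suc_mem_row by blast
    then have t: "t = Suc x" by simp
    have bump: "bump x ?R = ([Suc x], ?R)"
      using bump_append[of A x "x # t # \<tau> @ C"] Cons.prems(3) by (simp add: sorted_wrt_append)
    have "ck_equiv (?R @ [x]) (Suc x # ?R)"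
      using bump_ck_equiv[OF sorted red] bump by simp
    from ck_equiv_append_right[OF this, of \<sigma>] have "reduced_word (Suc x # ?R @ \<sigma>)"
      using Cons.prems(5) True by (simp add: reduced_word_ck_equiv)
    then have "reduced_word (?R @ \<sigma>)"
      using reduced_word_appendD2[of "[Suc x]"] by simp
    moreover have less_\<sigma>: "\<forall>y\<in>set \<sigma>. x < y" using Cons.prems(2) True by simp
    ultimately have "row_ins ?R \<sigma> = (\<tau>, A @ x # t # hat_block t \<tau> \<sigma> @ C)"
      using Cons.IH[OF less, of "A @ [x]" t] Cons.prems(2,3) t by (simp add: Suc_le_eq)
    moreover have "hat_block x (t # \<tau>) (s # \<sigma>) = t # hat_block t \<tau> \<sigma>"
      using hat_count_Cons[OF Cons.hyps less less_\<sigma>] by (simp add: hat_block_def t True)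
    ultimately show ?thesis using bump True t by simp
  next
    case False
    then have "x < s" using Cons.prems(4) by (simp add: le_neq_implies_less)
    then have "hat_block x (t # \<tau>) (s # \<sigma>) = s # \<sigma>"
      using st by (intro hat_block_no_hat) simp
    moreover have "sorted_wrt (<) ((A @ [x]) @ s # \<sigma>)"
      using Cons.prems(2-4) \<open>x < s\<close> by (fastforce simp: sorted_wrt_append)
    ultimately show ?thesis
      using row_ins_block[of "t # \<tau>" "s # \<sigma>" "A @ [x]" C] Cons.hyps Cons.prems(1) by simp
  qed
qed (simp add: hat_block_no_hat)

text \<open>Only weak inequality is available because a raised letter may reach the next letter of
  \<sigma>. Equality is excluded by reducedness: the first letter of \<sigma> would be in S, hence
  also its successor, which exceeds every bound on S.\<close>

lemma row_ins_overflow: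
  assumes "sorted_wrt (<) S" "sorted_wrt (<) \<sigma>" "\<forall>z\<in>set S. \<forall>y\<in>set \<sigma>. z \<le> y" "reduced_word (S @ \<sigma>)"
  shows "row_ins S \<sigma> = ([], S @ \<sigma>)"
proof (cases \<sigma>)
  case (Cons y \<sigma>')
  have "reduced_word (S @ [y])"
    using assms(4) reduced_word_appendD1[of "S @ [y]" \<sigma>'] Cons by simp
  then have "y \<notin> set S"
    using reduced_row_Suc_mem[OF assms(1)] assms(3) Cons by fastforce
  then have "sorted_wrt (<) (S @ \<sigma>)"
    using assms(1-3) Cons by (fastforce simp: sorted_wrt_append le_less)
  then show ?thesis by (rule row_ins_above)
qed simp

lemma reduced_word_row_ins:
  assumes "sorted_wrt (<) R" "reduced_word (R @ u @ v)" "row_ins R u = (p, S)"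
  shows "reduced_word (S @ v)"
proof -
  have "ck_equiv (R @ u) (p @ S)"
    using row_ins_ck_equiv[OF assms(1) _ assms(3)] assms(2) reduced_word_appendD1[of "R @ u" v] by simp
  from ck_equiv_append_right[OF this, of v] have "reduced_word (p @ S @ v)"
    using assms(2) by (simp add: reduced_word_ck_equiv)
  then show ?thesis by (rule reduced_word_appendD2)
qed

lemma sorted_row_ins: "sorted_wrt (<) R \<Longrightarrow> row_ins R w = (p, S) \<Longrightarrow> sorted_wrt (<) S"
  by (induction w arbitrary: R p) (auto split: prod.splits, metis sorted_bump snd_conv)

lemma row_ins_split:
  "row_ins R (take n \<sigma>) = (p, S) \<Longrightarrow> row_ins S (drop n \<sigma>) = (q, T) \<Longrightarrow> row_ins R \<sigma> = (p @ q, T)"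
  using row_ins_append[of R "take n \<sigma>" "drop n \<sigma>"] by simp

text \<open>The state right of a free letter x: A is the finished part of the bottom row, and no
  remaining letter of \<sigma> is below x. At the next violation \<open>\<tau> ! j\<close> is the
  new free letter; the inequality \<open>\<tau> ! j \<le> \<sigma> ! j\<close> restores the state
  with a longer A.\<close>

lemma row_ins_drop_rows_hat:
  assumes "sorted_wrt (<) (A @ x # \<tau>)" "sorted_wrt (<) \<sigma>" "\<forall>y\<in>set \<sigma>. x \<le> y"
    "reduced_word ((A @ x # \<tau>) @ \<sigma>)"
  shows "row_ins (A @ x # \<tau>) \<sigma> =
    (case drop_rows_with (hat_block x) \<tau> \<sigma> of (T, B) \<Rightarrow> (T, A @ x # B))"
  using assms
proof (induction \<tau> arbitrary: A x \<sigma> rule: length_induct)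
  case (1 \<tau>)
  note prems = 1(2-5)
  have block: "row_ins (A @ x # \<tau>) (take n \<sigma>) =
      (take n \<tau>, A @ x # hat_block x (take n \<tau>) (take n \<sigma>) @ drop n \<tau>)"
    if "n \<le> length \<tau>" "n \<le> length \<sigma>" "\<forall>i<n. \<sigma> ! i < \<tau> ! i" for n
  proof -
    have "reduced_word ((A @ x # \<tau>) @ take n \<sigma>)"
      using prems(4) reduced_word_appendD1[of "(A @ x # \<tau>) @ take n \<sigma>" "drop n \<sigma>"] by simp
    moreover have "\<forall>y\<in>set (take n \<sigma>). x \<le> y" using prems(3) by (meson in_set_takeD)
    ultimately show ?thesis
      using row_ins_hat_block[of "take n \<tau>" "take n \<sigma>" A x "drop n \<tau>"] prems(1,2) that
      by (simp add: sorted_wrt_take)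
  qed
  show ?case
  proof (cases "\<forall>j < min (length \<sigma>) (length \<tau>). \<tau> ! j > \<sigma> ! j")
    case True
    show ?thesis
    proof (cases "length \<sigma> \<le> length \<tau>")
      case le: True
      with True block[of "length \<sigma>"] show ?thesis
        by (simp add: drop_rows_with_fits[OF True])
    next
      case False
      let ?n = "length \<tau>" and ?S = "A @ x # hat_block x \<tau> (take (length \<tau>) \<sigma>)"
      have S: "row_ins (A @ x # \<tau>) (take ?n \<sigma>) = (\<tau>, ?S)"
        using True False block[of ?n] by simp
      have sorted: "sorted_wrt (<) ?S"
        using sorted_row_ins[OF prems(1) S] .
      have red: "reduced_word (?S @ drop ?n \<sigma>)"
        using reduced_word_row_ins[OF prems(1) _ S, of "drop ?n \<sigma>"] prems(4) by simp
      \<comment> \<open>A raised letter is u + 1 for a letter u of \<sigma> before y, so it is at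
        most y.\<close>
      have "z \<le> y" if "z \<in> set ?S" "y \<in> set (drop ?n \<sigma>)" for z y
      proof -
        have "x \<le> y" using prems(3) that(2) by (auto dest: in_set_dropD)
        moreover have "\<forall>a\<in>set A. a < x" using prems(1) by (simp add: sorted_wrt_append)
        moreover have "\<forall>u\<in>set (take ?n \<sigma>). u < y"
          using prems(2) that(2) sorted_wrt_append[of "(<)" "take ?n \<sigma>" "drop ?n \<sigma>"] by simp
        moreover have "z \<in> set A \<or> z = x \<or> z \<in> set (take ?n \<sigma>) \<or> z \<in> Suc ` set (take ?n \<sigma>)"
          using that(1) set_hat_block[of x \<tau> "take ?n \<sigma>"] by auto
        ultimately show ?thesis
          by (elim disjE imageE) (force simp: Suc_le_eq)+
      qed
      then have "row_ins ?S (drop ?n \<sigma>) = ([], ?S @ drop ?n \<sigma>)"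
        using prems(2) by (intro row_ins_overflow sorted red ballI sorted_wrt_drop)
      from row_ins_split[OF S this] have "row_ins (A @ x # \<tau>) \<sigma> = (\<tau>, ?S @ drop ?n \<sigma>)"
        by simp
      with False show ?thesis
        by (simp add: drop_rows_with_fits[OF True])
    qed
  next
    case False
    then obtain j where j: "j < min (length \<sigma>) (length \<tau>)" "\<tau> ! j \<le> \<sigma> ! j" "\<forall>i<j. \<sigma> ! i < \<tau> ! i"
      by (rule first_violation)
    let ?A = "A @ x # hat_block x (take j \<tau>) (take j \<sigma>)"
    have \<tau>: "drop j \<tau> = \<tau> ! j # drop (Suc j) \<tau>" using j(1) by (simp add: Cons_nth_drop_Suc)
    have S: "row_ins (A @ x # \<tau>) (take j \<sigma>) = (take j \<tau>, ?A @ \<tau> ! j # drop (Suc j) \<tau>)"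
      using block[of j] j \<tau> by simp
    have sorted: "sorted_wrt (<) (?A @ \<tau> ! j # drop (Suc j) \<tau>)"
      using sorted_row_ins[OF prems(1) S] .
    have red: "reduced_word ((?A @ \<tau> ! j # drop (Suc j) \<tau>) @ drop j \<sigma>)"
      using reduced_word_row_ins[OF prems(1) _ S, of "drop j \<sigma>"] prems(4) by simp
    have \<sigma>: "drop j \<sigma> = \<sigma> ! j # drop (Suc j) \<sigma>" using j(1) by (simp add: Cons_nth_drop_Suc)
    have sorted_\<sigma>: "sorted_wrt (<) (drop j \<sigma>)" using prems(2) by (simp add: sorted_wrt_drop)
    then have ge: "\<forall>y\<in>set (drop j \<sigma>). \<tau> ! j \<le> y" using j(2) unfolding \<sigma> by auto
    have "length (drop (Suc j) \<tau>) < length \<tau>" using j(1) by auto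
    from 1(1)[rule_format, OF this sorted sorted_\<sigma> _ red] ge
    have "row_ins (?A @ \<tau> ! j # drop (Suc j) \<tau>) (drop j \<sigma>) =
      (case drop_rows_with (hat_block (\<tau> ! j)) (drop (Suc j) \<tau>) (drop j \<sigma>) of
        (T, B) \<Rightarrow> (T, ?A @ \<tau> ! j # B))" by simp
    then show ?thesis
      using row_ins_split[OF S]
      by (cases "drop_rows_with (hat_block (\<tau> ! j)) (drop (Suc j) \<tau>) (drop j \<sigma>)")
        (simp add: drop_rows_with_violation[OF j])
  qed
qed

lemma drop_rows_eq_row_ins:
  assumes "sorted_wrt (<) \<tau>" "sorted_wrt (<) \<sigma>" "reduced_word (\<tau> @ \<sigma>)"
  shows "drop_rows \<tau> \<sigma> = row_ins \<tau> \<sigma>"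
proof (cases "\<forall>j < min (length \<sigma>) (length \<tau>). \<tau> ! j > \<sigma> ! j")
  case True
  let ?s = "length \<sigma>" and ?t = "length \<tau>"
  have "row_ins \<tau> (take ?t \<sigma>) = (take ?s \<tau>, take ?t \<sigma> @ drop ?s \<tau>)"
    using row_ins_block[of "take ?s \<tau>" "take ?t \<sigma>" "[]" "drop ?s \<tau>"] True assms(2)
    by (simp add: sorted_wrt_take)
  from row_ins_split[OF this, of "[]" "take ?t \<sigma> @ drop ?s \<tau> @ drop ?t \<sigma>"]
  have "row_ins \<tau> \<sigma> = (take ?s \<tau>, take ?t \<sigma> @ drop ?s \<tau> @ drop ?t \<sigma>)"
    if "row_ins (take ?t \<sigma> @ drop ?s \<tau>) (drop ?t \<sigma>) = ([], take ?t \<sigma> @ drop ?s \<tau> @ drop ?t \<sigma>)"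
    using that by simp
  moreover have "row_ins (take ?t \<sigma> @ drop ?s \<tau>) (drop ?t \<sigma>) =
      ([], take ?t \<sigma> @ drop ?s \<tau> @ drop ?t \<sigma>)"
    using row_ins_above[of "take ?t \<sigma>" "drop ?t \<sigma>"] assms(2) by (cases "?s \<le> ?t") simp_all
  ultimately have "row_ins \<tau> \<sigma> = (take ?s \<tau>, take ?t \<sigma> @ drop ?s \<tau> @ drop ?t \<sigma>)"
    by blast
  then show ?thesis by (simp add: drop_rows_eq_with drop_rows_with_fits[OF True])
next
  case False
  then obtain j where j: "j < min (length \<sigma>) (length \<tau>)" "\<tau> ! j \<le> \<sigma> ! j" "\<forall>i<j. \<sigma> ! i < \<tau> ! i"
    by (rule first_violation)
  have \<tau>: "\<tau> = take j \<tau> @ \<tau> ! j # drop (Suc j) \<tau>" using j(1) by (simp add: id_take_nth_drop)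
  have \<sigma>: "drop j \<sigma> = \<sigma> ! j # drop (Suc j) \<sigma>" using j(1) by (simp add: Cons_nth_drop_Suc)
  have "row_ins (take j \<tau> @ \<tau> ! j # drop (Suc j) \<tau>) (take j \<sigma>) =
      (take j \<tau>, take j \<sigma> @ \<tau> ! j # drop (Suc j) \<tau>)"
    using row_ins_block[of "take j \<tau>" "take j \<sigma>" "[]" "\<tau> ! j # drop (Suc j) \<tau>"] j assms(2)
    by (simp add: sorted_wrt_take)
  then have S: "row_ins \<tau> (take j \<sigma>) = (take j \<tau>, take j \<sigma> @ \<tau> ! j # drop (Suc j) \<tau>)"
    using \<tau> by simp
  have sorted_\<sigma>: "sorted_wrt (<) (drop j \<sigma>)" using assms(2) by (simp add: sorted_wrt_drop)
  then have "\<forall>y\<in>set (drop j \<sigma>). \<tau> ! j \<le> y" using j(2) unfolding \<sigma> by auto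
  from row_ins_drop_rows_hat[OF sorted_row_ins[OF assms(1) S] sorted_\<sigma> this
      reduced_word_row_ins[OF assms(1) _ S]] assms(3)
  have "row_ins (take j \<sigma> @ \<tau> ! j # drop (Suc j) \<tau>) (drop j \<sigma>) =
    (case drop_rows_with (hat_block (\<tau> ! j)) (drop (Suc j) \<tau>) (drop j \<sigma>) of
      (T, B) \<Rightarrow> (T, take j \<sigma> @ \<tau> ! j # B))" by simp
  then show ?thesis
    using row_ins_split[OF S]
    by (cases "drop_rows_with (hat_block (\<tau> ! j)) (drop (Suc j) \<tau>) (drop j \<sigma>)")
      (simp add: drop_rows_eq_with drop_rows_with_violation[OF j])
qed

text \<open>The new top row is \<tau> with its free letters removed. That it increases is read off
  the alignment; the insertion argument controls only the bottom row.\<close>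

lemma drop_rows_with_top:
  assumes "sorted_wrt (<) \<tau>" "drop_rows_with f \<tau> \<sigma> = (T, B)"
  shows "sorted_wrt (<) T \<and> set T \<subseteq> set \<tau> \<and> length T \<le> length \<tau>"
  using assms
proof (induction \<tau> arbitrary: f \<sigma> T B rule: length_induct)
  case (1 \<tau>)
  show ?case
  proof (cases "\<forall>j < min (length \<sigma>) (length \<tau>). \<tau> ! j > \<sigma> ! j")
    case True
    with 1(2,3) show ?thesis
      by (auto simp: drop_rows_with_fits sorted_wrt_take dest: in_set_takeD)
  next
    case False
    then obtain j where j: "j < min (length \<sigma>) (length \<tau>)" "\<tau> ! j \<le> \<sigma> ! j" "\<forall>i<j. \<sigma> ! i < \<tau> ! i"
      by (rule first_violation)
    let ?\<tau> = "drop (Suc j) \<tau>"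
    obtain T' B' where T': "drop_rows_with (hat_block (\<tau> ! j)) ?\<tau> (drop j \<sigma>) = (T', B')" by fastforce
    have len: "length ?\<tau> < length \<tau>" using j(1) by auto
    have sorted: "sorted_wrt (<) ?\<tau>" using 1(2) by (simp add: sorted_wrt_drop)
    have IH: "sorted_wrt (<) T'" "set T' \<subseteq> set ?\<tau>" "length T' \<le> length ?\<tau>"
      using 1(1) len sorted T' by blast+
    have T: "T = take j \<tau> @ T'" using 1(3) T' by (simp add: drop_rows_with_violation[OF j])
    have "take j \<tau> @ \<tau> ! j # ?\<tau> = \<tau>" using j(1) by (simp add: id_take_nth_drop[symmetric])
    with 1(2) have "sorted_wrt (<) (take j \<tau> @ \<tau> ! j # ?\<tau>)" by simp
    with IH T have "sorted_wrt (<) T" by (auto simp: sorted_wrt_append)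
    moreover have "set T \<subseteq> set \<tau>" using IH(2) T by (auto dest: in_set_takeD in_set_dropD)
    ultimately show ?thesis using IH(3) T j(1) by auto
  qed
qed

text \<open>Either permitted reason for a drop creates a free letter, and free letters leave the
  upper row. This is what makes the procedure terminate.\<close>

lemma drop_rows_top_shorter:
  assumes "sorted_wrt (<) \<tau>" "drop_rows \<tau> \<sigma> = (T, B)"
    "length \<sigma> < length \<tau> \<or> (\<exists>j < min (length \<sigma>) (length \<tau>). \<tau> ! j \<le> \<sigma> ! j)"
  shows "length T < length \<tau>"
proof (cases "\<forall>j < min (length \<sigma>) (length \<tau>). \<tau> ! j > \<sigma> ! j")
  case True
  then have "length \<sigma> < length \<tau>" using assms(3) by fastforce
  with True assms(2) show ?thesis by (auto simp: drop_rows_eq_with drop_rows_with_fits)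
next
  case False
  then obtain j where j: "j < min (length \<sigma>) (length \<tau>)" "\<tau> ! j \<le> \<sigma> ! j" "\<forall>i<j. \<sigma> ! i < \<tau> ! i"
    by (rule first_violation)
  obtain T' B' where T': "drop_rows_with (hat_block (\<tau> ! j)) (drop (Suc j) \<tau>) (drop j \<sigma>) = (T', B')"
    by fastforce
  have "length T' \<le> length (drop (Suc j) \<tau>)"
    using drop_rows_with_top[OF _ T'] assms(1) by (simp add: sorted_wrt_drop)
  moreover have "T = take j \<tau> @ T'"
    using assms(2) T' by (simp add: drop_rows_eq_with drop_rows_with_violation[OF j])
  ultimately show ?thesis using j(1) by auto
qed

subsection \<open>The drop procedure\<close>

text \<open>The sum of the row indices of all letters, where the bottom row has index 0.\<close>

fun row_weight :: "array \<Rightarrow> nat" where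
  "row_weight [] = 0"
| "row_weight (r # R) = row_weight R + length (concat R)"

lemma row_weight_append:
  "row_weight (P @ R) = row_weight P + length P * length (concat R) + row_weight R"
  by (induction P) auto

lemma drop_stepE:
  assumes "drop_step R R'"
  obtains P \<sigma> \<tau> Q T B where "R = P @ \<sigma> # \<tau> # Q" "R' = P @ B # T # Q" "drop_rows \<tau> \<sigma> = (T, B)"
    "length \<sigma> < length \<tau> \<or> (\<exists>j < min (length \<sigma>) (length \<tau>). \<tau> ! j \<le> \<sigma> ! j)"
proof -
  obtain k where k: "Suc k < length R" "R' = drop_at k R"
    "length (R ! Suc k) > length (R ! k) \<or>
       (\<exists>j < min (length (R ! k)) (length (R ! Suc k)). R ! Suc k ! j \<le> R ! k ! j)"
    using assms by (auto simp: drop_step_def)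
  define P Q where "P = take k R" and "Q = drop (Suc (Suc k)) R"
  have R: "R = P @ R ! k # R ! Suc k # Q"
    using k(1) by (simp add: P_def Q_def Cons_nth_drop_Suc)
  obtain T B where T: "drop_rows (R ! Suc k) (R ! k) = (T, B)" by fastforce
  have "R' = R[Suc k := T, k := B]"
    using k(2) T by (simp add: drop_at_def)
  also have "\<dots> = P @ B # T # Q"
    using k(1) by (subst R) (simp add: P_def list_update_append)
  finally show ?thesis using that R T k(3) by blast
qed

lemma drop_step_invariant:
  assumes "drop_admissible R" "drop_step R R'"
  shows "drop_admissible R'" "ck_equiv (row_reading_word R) (row_reading_word R')"
    "row_weight R' < row_weight R"
proof -
  obtain P \<sigma> \<tau> Q T B where R: "R = P @ \<sigma> # \<tau> # Q" and R': "R' = P @ B # T # Q"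
    and T: "drop_rows \<tau> \<sigma> = (T, B)"
    and viol: "length \<sigma> < length \<tau> \<or> (\<exists>j < min (length \<sigma>) (length \<tau>). \<tau> ! j \<le> \<sigma> ! j)"
    using assms(2) by (rule drop_stepE)
  let ?u = "row_reading_word Q" and ?v = "row_reading_word P"
  have word: "row_reading_word R = ?u @ (\<tau> @ \<sigma>) @ ?v" "row_reading_word R' = ?u @ (T @ B) @ ?v"
    by (simp_all add: R R' row_reading_word_def)
  have sorted: "sorted_wrt (<) \<tau>" "sorted_wrt (<) \<sigma>" and red: "reduced_word (row_reading_word R)"
    using assms(1) by (auto simp: drop_admissible_def R)
  then have red': "reduced_word (\<tau> @ \<sigma>)"
    using word(1) reduced_word_appendD1 reduced_word_appendD2 by metis
  with sorted T have ins: "row_ins \<tau> \<sigma> = (T, B)" by (simp add: drop_rows_eq_row_ins)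
  have ck: "ck_equiv (\<tau> @ \<sigma>) (T @ B)" and B: "sorted_wrt (<) B"
    using row_ins_ck_equiv[OF sorted(1) red' ins] .
  show ck': "ck_equiv (row_reading_word R) (row_reading_word R')"
    unfolding word by (rule ck_equiv_context[OF ck])
  have "sorted_wrt (<) T"
    using drop_rows_with_top[OF sorted(1)] T by (simp add: drop_rows_eq_with)
  with B red ck' show "drop_admissible R'"
    using assms(1) reduced_word_ck_equiv by (auto simp: drop_admissible_def R R')
  have "length T < length \<tau>" by (rule drop_rows_top_shorter[OF sorted(1) T viol])
  \<comment> \<open>The two rows keep their total number of letters, so the weight falls by exactly
    the number of letters lost by the upper row.\<close>
  moreover have "length B + length T = length \<sigma> + length \<tau>"
    using ck_equiv_invariants[OF ck] by simp
  then have "length B * length P + length T * length P = length \<sigma> * length P + length \<tau> * length P"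
    by (simp flip: add_mult_distrib)
  ultimately show "row_weight R' < row_weight R"
    unfolding R R' row_weight_append by (simp add: algebra_simps)
qed

lemma drop_step_progress:
  assumes "drop_admissible R" "\<not> drop_finished R"
  shows "\<exists>R'. drop_step R R'"
proof (rule ccontr)
  let ?P = "\<lambda>r s :: nat list. length s \<le> length r \<and> (\<forall>j<length s. r ! j < s ! j)"
  assume "\<nexists>R'. drop_step R R'"
  then have no_step: "\<not> drop_step R (drop_at k R)" for k by blast
  have "?P (R ! k) (R ! Suc k)" if "Suc k < length R" for k
    using no_step[of k] assms(2) that
    by (simp add: drop_step_def not_less) (metis linorder_not_less order.strict_trans2)
  then have "successively ?P R" by (simp add: successively_conv_nth)
  \<comment> \<open>Rows adjacent in the filtered array need not be adjacent in R; transitivity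
    bridges the removed empty rows.\<close>
  moreover have "transp ?P" by (rule transpI) (metis order.strict_trans order.strict_trans2 order.trans)
  ultimately have "sorted_wrt ?P R" using successively_conv_sorted_wrt by blast
  then have "sorted_wrt ?P (filter (\<lambda>r. r \<noteq> []) R)" by (rule sorted_wrt_filter)
  then have "drop_finished R"
    using assms(1) unfolding drop_finished_def increasing_young_tableau_def drop_admissible_def
    by (auto simp: sorted_wrt_iff_nth_less)
  with assms(2) show False by simp
qed

section \<open>Runs and reading words of tableaux\<close>

lemma runs_Cons_hd: "runs (a # \<rho>) \<noteq> [] \<and> hd (runs (a # \<rho>)) \<noteq> [] \<and> hd (hd (runs (a # \<rho>))) = a"
  by (cases \<rho>) auto

lemma concat_runs: "concat (runs \<rho>) = \<rho>"
proof (induction \<rho> rule: runs.induct)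
  case (3 a b \<rho>)
  then show ?case using runs_Cons_hd[of b \<rho>] by (cases "runs (b # \<rho>)") auto
qed auto

lemma runs_sorted: "\<forall>r\<in>set (runs \<rho>). sorted_wrt (<) r \<and> r \<noteq> []"
proof (induction \<rho> rule: runs.induct)
  case (3 a b \<rho>)
  obtain q R where q: "runs (b # \<rho>) = q # R"
    using runs_Cons_hd[of b \<rho>] by (cases "runs (b # \<rho>)") auto
  moreover obtain r where "q = b # r"
    using runs_Cons_hd[of b \<rho>] q by (cases q) auto
  ultimately show ?case using 3 by (cases "a < b") (simp_all, fastforce)
qed auto

lemma runs_increasing: "sorted_wrt (<) r \<Longrightarrow> r \<noteq> [] \<Longrightarrow> runs r = [r]"
  by (induction r rule: runs.induct) auto

lemma runs_append_descent:
  "u \<noteq> [] \<Longrightarrow> v \<noteq> [] \<Longrightarrow> hd v \<le> last u \<Longrightarrow> runs (u @ v) = runs u @ runs v"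
proof (induction u rule: runs.induct)
  case (2 a)
  then show ?case by (cases v) auto
next
  case (3 a b \<rho>)
  then show ?case using runs_Cons_hd[of b \<rho>] by auto
qed simp

text \<open>Rows are runs because each boundary is a descent: the first entry of a row is below the
  first entry of the next row up, hence below its last entry.\<close>

lemma descent_tableau_row_reading_word:
  "increasing_young_tableau T \<Longrightarrow> [] \<notin> set T \<Longrightarrow> descent_tableau (row_reading_word T) = T"
proof (induction T)
  case (Cons r T)
  have r: "sorted_wrt (<) r" "r \<noteq> []" using Cons.prems by (auto simp: increasing_young_tableau_def)
  have IH: "rev (runs (row_reading_word T)) = T"
    using Cons increasing_young_tableau_ConsD by (simp add: descent_tableau_def)
  show ?case
  proof (cases T)
    case Nil
    then show ?thesis using r by (simp add: descent_tableau_def row_reading_word_def runs_increasing)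
  next
    case T: (Cons s S)
    have s: "sorted_wrt (<) s" "s \<noteq> []" "r ! 0 < s ! 0"
      using Cons.prems by (force simp: increasing_young_tableau_def T)+
    have "s ! 0 \<le> last s"
      using s(1,2) by (cases s) (auto simp: order.strict_implies_order)
    then have "hd r \<le> last (row_reading_word T)"
      using r(2) s by (simp add: row_reading_word_def T hd_conv_nth)
    moreover have "row_reading_word T \<noteq> []" using s by (simp add: row_reading_word_def T)
    ultimately have "runs (row_reading_word T @ r) = runs (row_reading_word T) @ [r]"
      using runs_append_descent r runs_increasing by simp
    with IH show ?thesis by (simp add: descent_tableau_def row_reading_word_def)
  qed
qed (simp add: descent_tableau_def row_reading_word_def)

lemma row_reading_word_descent_tableau: "row_reading_word (descent_tableau \<rho>) = \<rho>"
  by (simp add: row_reading_word_def descent_tableau_def concat_runs)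

lemma row_reading_word_filter: "row_reading_word (filter (\<lambda>r. r \<noteq> []) R) = row_reading_word R"
  by (induction R) (auto simp: row_reading_word_def)

section \<open>Termination, uniqueness and the resulting word\<close>

lemma drop_reachable_invariant:
  assumes "reduced_word \<rho>" "drop_reachable \<rho> R"
  shows "drop_admissible R \<and> ck_equiv \<rho> (row_reading_word R)"
  using assms(2) unfolding drop_reachable_def
proof (induction rule: rtranclp_induct)
  case base
  then show ?case
    using assms(1) runs_sorted[of \<rho>]
    by (simp add: drop_admissible_def row_reading_word_descent_tableau) (simp add: descent_tableau_def)
next
  case (step R R')
  then show ?case using drop_step_invariant ck_equiv_trans by blast
qed

lemma drop_step_terminates:
  "drop_admissible R \<Longrightarrow> \<exists>R'. drop_step\<^sup>*\<^sup>* R R' \<and> drop_finished R'"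
proof (induction R rule: measure_induct_rule[of row_weight])
  case (less R)
  show ?case
  proof (cases "drop_finished R")
    case False
    then obtain S where S: "drop_step R S" using drop_step_progress less.prems by blast
    with less.IH[of S] drop_step_invariant[OF less.prems S] show ?thesis
      by (meson converse_rtranclp_into_rtranclp)
  qed blast
qed

lemma tableau_word_unique:
  assumes "increasing_young_tableau (descent_tableau w)" "increasing_young_tableau (descent_tableau w')"
    "reduced_word w" "ck_equiv w w'"
  shows "w = w'"
proof -
  have "[] \<notin> set (descent_tableau v)" for v
    using runs_sorted[of v] by (auto simp: descent_tableau_def)
  then have "descent_tableau w = descent_tableau w'"
    using assms by (intro tableau_unique) (simp_all add: row_reading_word_descent_tableau)
  then show ?thesis by (metis row_reading_word_descent_tableau)
qed

theorem theorem4p10: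
  fixes \<rho> :: word
  assumes "reduced_word \<rho>"
  shows "drop_well_defined \<rho> \<and>
    (reduced_word (drop_word \<rho>) \<and> coxeter_knuth \<rho> (drop_word \<rho>) \<and>
     increasing_young_tableau (descent_tableau (drop_word \<rho>))) \<and>
    (\<forall>w. reduced_word w \<and> coxeter_knuth \<rho> w \<and> increasing_young_tableau (descent_tableau w)
       \<longrightarrow> w = drop_word \<rho>)"
proof -
  note inv = drop_reachable_invariant[OF assms]
  \<comment> \<open>A finished array may contain empty rows. Filtering them out does not change the
    word, and the rows that remain are its runs.\<close>
  have tableau: "increasing_young_tableau (descent_tableau (row_reading_word R))"
    if "drop_finished R" for R
    using that descent_tableau_row_reading_word[of "filter (\<lambda>r. r \<noteq> []) R"]
    by (simp add: drop_finished_def row_reading_word_filter)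
  have start: "drop_reachable \<rho> (descent_tableau \<rho>)" by (simp add: drop_reachable_def)
  from drop_step_terminates[of "descent_tableau \<rho>"] inv[OF this]
  obtain R where R: "drop_reachable \<rho> R" "drop_finished R"
    by (auto simp: drop_reachable_def)
  let ?w = "row_reading_word R"
  have w: "reduced_word ?w" "ck_equiv \<rho> ?w" "increasing_young_tableau (descent_tableau ?w)"
    using inv[OF R(1)] tableau[OF R(2)] by (auto simp: drop_admissible_def)
  have unique: "v = ?w"
    if "reduced_word v" "ck_equiv \<rho> v" "increasing_young_tableau (descent_tableau v)" for v
    using tableau_word_unique[OF that(3) w(3) that(1)] ck_equiv_trans[OF ck_equiv_sym[OF that(2)] w(2)]
    by simp
  \<comment> \<open>Independence of the choices: every finished array satisfies the characterisation
    for which \<open>unique\<close> leaves only one word.\<close>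
  have finished: "row_reading_word R' = ?w" if "drop_reachable \<rho> R'" "drop_finished R'" for R'
    using inv[OF that(1)] tableau[OF that(2)] by (intro unique) (simp_all add: drop_admissible_def)
  have drop_word: "drop_word \<rho> = ?w"
    unfolding drop_word_def
  proof (rule the_equality)
    fix v
    assume "\<exists>R'. drop_reachable \<rho> R' \<and> drop_finished R' \<and> v = row_reading_word R'"
    then show "v = ?w" using finished by auto
  qed (use R in blast)
  have "\<nexists>f. f 0 = descent_tableau \<rho> \<and> (\<forall>n. drop_step (f n) (f (Suc n)))"
  proof
    assume "\<exists>f. f 0 = descent_tableau \<rho> \<and> (\<forall>n. drop_step (f n) (f (Suc n)))"
    then obtain f where f: "f 0 = descent_tableau \<rho>" "\<And>n. drop_step (f n) (f (Suc n))" by blast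
    have reach: "drop_reachable \<rho> (f n)" for n
    proof (induction n)
      case (Suc n)
      with f(2)[of n] show ?case unfolding drop_reachable_def by (rule rtranclp.rtrancl_into_rtrancl[rotated])
    qed (use start f(1) in simp)
    \<comment> \<open>Each step costs at least 1 of the weight, so more steps than the initial
      weight are impossible.\<close>
    have "row_weight (f n) + n \<le> row_weight (f 0)" for n
    proof (induction n)
      case (Suc n)
      with drop_step_invariant(3)[OF _ f(2)[of n]] inv[OF reach[of n]] show ?case by simp
    qed simp
    from this[of "Suc (row_weight (f 0))"] show False by simp
  qed
  moreover have "\<forall>R'. drop_reachable \<rho> R' \<longrightarrow> drop_admissible R'" using inv by blast
  moreover have "\<forall>R'. drop_reachable \<rho> R' \<longrightarrow> drop_finished R' \<or> (\<exists>S. drop_step R' S)"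
    using inv drop_step_progress by blast
  moreover have "\<forall>R'. drop_reachable \<rho> R' \<and> drop_finished R' \<longrightarrow> row_reading_word R' = ?w"
    using finished by blast
  ultimately have "drop_well_defined \<rho>"
    unfolding drop_well_defined_def drop_word by (intro conjI)
  then show ?thesis
    unfolding coxeter_knuth_eq_ck_equiv drop_word using w unique by blast
qed

end
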